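(* Assume CH. Then there exists a non fin-intersecting MAD family $\mathcal A$ on $\omega$ such that $\mathbb C\Vdash$ "$\check{\mathcal A}$ is MAD and non fin-intersecting". More specifically, there exist such a MAD family $\mathcal A$ and a fin sequence $C$ (in the ground model) such that $C$ witnesses the non fin-intersectingness of $\mathcal A$ in every (iterated, with finite supports) Cohen extension; that is, for every cardinal $\kappa$, $\mathbb C_\kappa\Vdash$ "$\check C$ witnesses that $\check{\mathcal A}$ is not fin-intersecting".
   Context: An almost disjoint family (on $\omega$) is an infinite set $\mathcal A$ of infinite subsets of $\omega$ such that $a\cap b$ is finite for all distinct $a,b\in\mathcal A$. A MAD family is an almost disjoint family not properly contained in any other almost disjoint family. A family $\mathcal F\subseteq\mathcal P(\omega)$ is centered if $\bigcap\mathcal B$ is infinite for every finite nonempty $\mathcal B\subseteq\mathcal F$. A fin sequence is a function $C:\omega\to[\omega]^{<\omega}\setminus\{\emptyset\}$ such that $C(n)\cap C(m)=\emptyset$ whenever $n\neq m$. An almost disjoint family $\mathcal A$ is fin-intersecting if for every fin sequence $C$ there exists an infinite $I\subseteq\omega$ such that $\{\{n\in I:a\cap C(n)\neq\emptyset\}:a\in\mathcal A\}\setminus[I]^{<\omega}$ is centered. A fin sequence $C$ witnesses that $\mathcal A$ is not fin-intersecting if for every infinite $I\subseteq\omega$ the family $\{\{n\in I:a\cap C(n)\neq\emptyset\}:a\in\mathcal A\}\setminus[I]^{<\omega}$ is not centered. $\mathbb C$ is Cohen forcing (adding one Cohen real), and $\mathbb C_\kappa$ is the finite support iteration (equivalently,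 finite support product) of $\kappa$ copies of $\mathbb C$. *)

theory Defs
  imports Main "HOL-Library.Sublist"
begin

section \<open>Notions of the ground model\<close>

definition continuum_hypothesis :: bool where
  "continuum_hypothesis \<longleftrightarrow> (card_of (UNIV :: nat set set), cardSuc natLeq) \<in> ordIso"

definition almost_disjoint :: "nat set set \<Rightarrow> bool" where
  "almost_disjoint A \<longleftrightarrow>
     infinite A \<and> (\<forall>a\<in>A. infinite a) \<and> (\<forall>a\<in>A. \<forall>b\<in>A. a \<noteq> b \<longrightarrow> finite (a \<inter> b))"

definition mad :: "nat set set \<Rightarrow> bool" where
  "mad A \<longleftrightarrow> almost_disjoint A \<and> \<not> (\<exists>B. almost_disjoint B \<and> A \<subset> B)"

definition centered :: "nat set set \<Rightarrow> bool" where
  "centered F \<longleftrightarrow> (\<forall>B. finite B \<and> B \<noteq> {} \<and> B \<subseteq> F \<longrightarrow> infinite (\<Inter>B))"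

definition fin_seq :: "(nat \<Rightarrow> nat set) \<Rightarrow> bool" where
  "fin_seq C \<longleftrightarrow> (\<forall>n. finite (C n) \<and> C n \<noteq> {}) \<and> (\<forall>n m. n \<noteq> m \<longrightarrow> C n \<inter> C m = {})"

definition traces :: "nat set \<Rightarrow> (nat \<Rightarrow> nat set) \<Rightarrow> nat set set \<Rightarrow> nat set set" where
  "traces I C A = {{n \<in> I. a \<inter> C n \<noteq> {}} | a. a \<in> A} - {x. x \<subseteq> I \<and> finite x}"

definition fin_intersecting :: "nat set set \<Rightarrow> bool" where
  "fin_intersecting A \<longleftrightarrow>
     (\<forall>C. fin_seq C \<longrightarrow> (\<exists>I. infinite I \<and> centered (traces I C A)))"

definition witnesses_non_fi :: "(nat \<Rightarrow> nat set) \<Rightarrow> nat set set \<Rightarrow> bool" where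
  "witnesses_non_fi C A \<longleftrightarrow> fin_seq C \<and> (\<forall>I. infinite I \<longrightarrow> \<not> centered (traces I C A))"


section \<open>The forcing relation\<close>

text \<open>
  A notion of forcing is a set \<open>P\<close> of conditions with an order \<open>\<preceq>\<close>, where \<open>q \<preceq> p\<close> means that
  \<open>q\<close> is the stronger condition.  A statement about the extension is represented by the
  predicate ``\<open>p\<close> forces it''.  Negation, conjunction and the universal quantifier are interpreted
  by the usual recursive clauses of the forcing relation; the other connectives are the classical
  abbreviations.

  Names are the usual ones, sorted by the type of object they denote.
  \<^item> A natural number of the extension belongs to the ground model, so quantifiers over
    naturals range over the check names, i.e. over \<^typ>\<open>nat\<close>.
  \<^item> A name for a subset of \<open>\<omega>\<close> is a set of pairs (natural number, condition).
  \<^item> A name for a set of subsets of \<open>\<omega>\<close> is a set of pairs (name for a subset of \<open>\<omega>\<close>, condition).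
  \<^item> A name for a sequence of subsets of \<open>\<omega>\<close>, indexed by \<open>\<omega>\<close> or by a natural number, is
    given by the sequence of the names of its values.

  Every object of the respective sort in the extension has a name of this form.  Pairs whose second
  component is not a condition are ignored.
\<close>

type_synonym 'p prp = "'p \<Rightarrow> bool"
type_synonym ('x, 'p) set_name = "('x \<times> 'p) set"
type_synonym 'p real_name = "(nat, 'p) set_name"
type_synonym 'p family_name = "('p real_name, 'p) set_name"

locale forcing_notion =
  fixes P :: "'p set" and le :: "'p \<Rightarrow> 'p \<Rightarrow> bool" (infix \<open>\<preceq>\<close> 50)
begin

definition forced :: "'p prp \<Rightarrow> bool" where
  "forced \<phi> \<longleftrightarrow> (\<forall>p\<in>P. \<phi> p)"

subsection \<open>Connectives and quantifiers\<close>

definition ground :: "bool \<Rightarrow> 'p prp" (\<open>\<lbrakk>_\<rbrakk>\<close>) where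
  "\<lbrakk>b\<rbrakk> = (\<lambda>p. b)"

definition fnot :: "'p prp \<Rightarrow> 'p prp" (\<open>\<^bold>\<not> _\<close> [40] 40) where
  "(\<^bold>\<not> \<phi>) = (\<lambda>p. \<forall>q\<in>P. q \<preceq> p \<longrightarrow> \<not> \<phi> q)"

definition fconj :: "'p prp \<Rightarrow> 'p prp \<Rightarrow> 'p prp" (infixr \<open>\<^bold>\<and>\<close> 35) where
  "(\<phi> \<^bold>\<and> \<psi>) = (\<lambda>p. \<phi> p \<and> \<psi> p)"

definition fall :: "('x \<Rightarrow> 'p prp) \<Rightarrow> 'p prp" (binder \<open>\<^bold>\<forall>\<close> 10) where
  "(\<^bold>\<forall>x. \<phi> x) = (\<lambda>p. \<forall>x. \<phi> x p)"

definition fimp :: "'p prp \<Rightarrow> 'p prp \<Rightarrow> 'p prp" (infixr \<open>\<^bold>\<longrightarrow>\<close> 25) where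
  "(\<phi> \<^bold>\<longrightarrow> \<psi>) = (\<^bold>\<not> (\<phi> \<^bold>\<and> (\<^bold>\<not> \<psi>)))"

definition fiff :: "'p prp \<Rightarrow> 'p prp \<Rightarrow> 'p prp" (infixr \<open>\<^bold>\<longleftrightarrow>\<close> 25) where
  "(\<phi> \<^bold>\<longleftrightarrow> \<psi>) = ((\<phi> \<^bold>\<longrightarrow> \<psi>) \<^bold>\<and> (\<psi> \<^bold>\<longrightarrow> \<phi>))"

definition fex :: "('x \<Rightarrow> 'p prp) \<Rightarrow> 'p prp" (binder \<open>\<^bold>\<exists>\<close> 10) where
  "(\<^bold>\<exists>x. \<phi> x) = (\<^bold>\<not> (\<^bold>\<forall>x. \<^bold>\<not> \<phi> x))"

subsection \<open>Membership, equality and finiteness\<close>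

text \<open>
  The argument \<open>E\<close> is the forced equality of the elements.  The condition \<open>p\<close> forces
  \<open>x \<in> X\<close> iff the conditions \<open>r\<close> that force \<open>x = y\<close> for some pair \<open>(y, s) \<in> X\<close> with \<open>r \<preceq> s\<close> are
  dense below \<open>p\<close>.
\<close>
definition mem :: "('x \<Rightarrow> 'x \<Rightarrow> 'p prp) \<Rightarrow> 'x \<Rightarrow> ('x, 'p) set_name \<Rightarrow> 'p prp" where
  "mem E x X = (\<lambda>p. \<forall>q\<in>P. q \<preceq> p \<longrightarrow>
     (\<exists>r\<in>P. r \<preceq> q \<and> (\<exists>(y, s)\<in>X. s \<in> P \<and> r \<preceq> s \<and> E x y r)))"

definition nat_eq :: "nat \<Rightarrow> nat \<Rightarrow> 'p prp" where
  "nat_eq n m = \<lbrakk>n = m\<rbrakk>"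

definition nat_mem :: "nat \<Rightarrow> 'p real_name \<Rightarrow> 'p prp" (infix \<open>\<^bold>\<in>\<close> 50) where
  "(n \<^bold>\<in> x) = mem nat_eq n x"

definition real_eq :: "'p real_name \<Rightarrow> 'p real_name \<Rightarrow> 'p prp" (infix \<open>\<^bold>=\<close> 50) where
  "(x \<^bold>= y) = (\<^bold>\<forall>n. n \<^bold>\<in> x \<^bold>\<longleftrightarrow> n \<^bold>\<in> y)"

definition real_mem :: "'p real_name \<Rightarrow> 'p family_name \<Rightarrow> 'p prp" (infix \<open>\<^bold>\<in>\<^bold>\<in>\<close> 50) where
  "(x \<^bold>\<in>\<^bold>\<in> X) = mem real_eq x X"

definition family_subset :: "'p family_name \<Rightarrow> 'p family_name \<Rightarrow> 'p prp" where
  "family_subset X Y = (\<^bold>\<forall>x. x \<^bold>\<in>\<^bold>\<in> X \<^bold>\<longrightarrow> x \<^bold>\<in>\<^bold>\<in> Y)"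

text \<open>
  ``The set of all \<open>x\<close> with \<open>\<phi> x\<close> is finite'': it is enumerated by some finite sequence.
\<close>
definition fin :: "('x \<Rightarrow> 'x \<Rightarrow> 'p prp) \<Rightarrow> ('x \<Rightarrow> 'p prp) \<Rightarrow> 'p prp" where
  "fin E \<phi> = (\<^bold>\<exists>ys :: 'x list. \<^bold>\<forall>x. \<phi> x \<^bold>\<longleftrightarrow> (\<^bold>\<exists>y. \<lbrakk>y \<in> set ys\<rbrakk> \<^bold>\<and> E x y))"

definition fin_nats :: "(nat \<Rightarrow> 'p prp) \<Rightarrow> 'p prp" where
  "fin_nats \<phi> = fin nat_eq \<phi>"

definition fin_family :: "'p family_name \<Rightarrow> 'p prp" where
  "fin_family X = fin real_eq (\<lambda>x. x \<^bold>\<in>\<^bold>\<in> X)"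

subsection \<open>Check names\<close>

definition check_real :: "nat set \<Rightarrow> 'p real_name" where
  "check_real a = a \<times> P"

definition check_family :: "nat set set \<Rightarrow> 'p family_name" where
  "check_family A = (check_real ` A) \<times> P"

definition check_seq :: "(nat \<Rightarrow> nat set) \<Rightarrow> nat \<Rightarrow> 'p real_name" where
  "check_seq C = (\<lambda>n. check_real (C n))"

subsection \<open>The notions of the first section, interpreted in the extension\<close>

definition almost_disjoint_ext :: "'p family_name \<Rightarrow> 'p prp" where
  "almost_disjoint_ext A =
     ((\<^bold>\<not> fin_family A) \<^bold>\<and>
      (\<^bold>\<forall>a. a \<^bold>\<in>\<^bold>\<in> A \<^bold>\<longrightarrow> (\<^bold>\<not> fin_nats (\<lambda>n. n \<^bold>\<in> a))) \<^bold>\<and>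
      (\<^bold>\<forall>a. a \<^bold>\<in>\<^bold>\<in> A \<^bold>\<longrightarrow> (\<^bold>\<forall>b. b \<^bold>\<in>\<^bold>\<in> A \<^bold>\<longrightarrow>
         (\<^bold>\<not> a \<^bold>= b) \<^bold>\<longrightarrow> fin_nats (\<lambda>n. n \<^bold>\<in> a \<^bold>\<and> n \<^bold>\<in> b))))"

definition mad_ext :: "'p family_name \<Rightarrow> 'p prp" where
  "mad_ext A =
     (almost_disjoint_ext A \<^bold>\<and>
      (\<^bold>\<not> (\<^bold>\<exists>B. almost_disjoint_ext B \<^bold>\<and> family_subset A B \<^bold>\<and> (\<^bold>\<not> family_subset B A))))"

text \<open>Here \<open>F\<close> is a definable family of subsets of \<open>\<omega>\<close>, given by its defining property.\<close>
definition centered_ext :: "('p real_name \<Rightarrow> 'p prp) \<Rightarrow> 'p prp" where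
  "centered_ext F =
     (\<^bold>\<forall>B. fin_family B \<^bold>\<and> (\<^bold>\<exists>b. b \<^bold>\<in>\<^bold>\<in> B) \<^bold>\<and> (\<^bold>\<forall>b. b \<^bold>\<in>\<^bold>\<in> B \<^bold>\<longrightarrow> F b) \<^bold>\<longrightarrow>
        (\<^bold>\<not> fin_nats (\<lambda>n. \<^bold>\<forall>b. b \<^bold>\<in>\<^bold>\<in> B \<^bold>\<longrightarrow> n \<^bold>\<in> b)))"

definition fin_seq_ext :: "(nat \<Rightarrow> 'p real_name) \<Rightarrow> 'p prp" where
  "fin_seq_ext C =
     ((\<^bold>\<forall>n. fin_nats (\<lambda>k. k \<^bold>\<in> C n) \<^bold>\<and> (\<^bold>\<exists>k. k \<^bold>\<in> C n)) \<^bold>\<and>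
      (\<^bold>\<forall>n m. (\<^bold>\<not> nat_eq n m) \<^bold>\<longrightarrow> (\<^bold>\<not> (\<^bold>\<exists>k. k \<^bold>\<in> C n \<^bold>\<and> k \<^bold>\<in> C m))))"

definition traces_ext ::
    "'p real_name \<Rightarrow> (nat \<Rightarrow> 'p real_name) \<Rightarrow> 'p family_name \<Rightarrow> 'p real_name \<Rightarrow> 'p prp" where
  "traces_ext I C A x =
     ((\<^bold>\<exists>a. a \<^bold>\<in>\<^bold>\<in> A \<^bold>\<and> (\<^bold>\<forall>n. n \<^bold>\<in> x \<^bold>\<longleftrightarrow> n \<^bold>\<in> I \<^bold>\<and> (\<^bold>\<exists>k. k \<^bold>\<in> a \<^bold>\<and> k \<^bold>\<in> C n))) \<^bold>\<and>
      (\<^bold>\<not> ((\<^bold>\<forall>n. n \<^bold>\<in> x \<^bold>\<longrightarrow> n \<^bold>\<in> I) \<^bold>\<and> fin_nats (\<lambda>n. n \<^bold>\<in> x))))"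

definition fin_intersecting_ext :: "'p family_name \<Rightarrow> 'p prp" where
  "fin_intersecting_ext A =
     (\<^bold>\<forall>C. fin_seq_ext C \<^bold>\<longrightarrow>
        (\<^bold>\<exists>I. (\<^bold>\<not> fin_nats (\<lambda>n. n \<^bold>\<in> I)) \<^bold>\<and> centered_ext (traces_ext I C A)))"

definition witnesses_non_fi_ext :: "(nat \<Rightarrow> 'p real_name) \<Rightarrow> 'p family_name \<Rightarrow> 'p prp" where
  "witnesses_non_fi_ext C A =
     (fin_seq_ext C \<^bold>\<and>
      (\<^bold>\<forall>I. (\<^bold>\<not> fin_nats (\<lambda>n. n \<^bold>\<in> I)) \<^bold>\<longrightarrow> (\<^bold>\<not> centered_ext (traces_ext I C A))))"

definition forces_mad_non_fi :: "nat set set \<Rightarrow> bool" where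
  "forces_mad_non_fi A \<longleftrightarrow>
     forced (mad_ext (check_family A) \<^bold>\<and> (\<^bold>\<not> fin_intersecting_ext (check_family A)))"

definition forces_witnesses_non_fi :: "(nat \<Rightarrow> nat set) \<Rightarrow> nat set set \<Rightarrow> bool" where
  "forces_witnesses_non_fi C A \<longleftrightarrow>
     forced (witnesses_non_fi_ext (check_seq C) (check_family A))"

end


section \<open>Cohen forcing\<close>

type_synonym cohen_cond = "bool list"

definition cohen :: "cohen_cond set" where
  "cohen = UNIV"

definition cohen_le :: "cohen_cond \<Rightarrow> cohen_cond \<Rightarrow> bool" where
  "cohen_le q p \<longleftrightarrow> prefix p q"

text \<open>The finite support product of copies of Cohen forcing, indexed by the elements of \<open>K\<close>.\<close>

definition cohen_product :: "'k set \<Rightarrow> ('k \<Rightarrow> cohen_cond) set" where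
  "cohen_product K =
     {p. (\<forall>i. p i \<in> cohen) \<and> finite {i. p i \<noteq> []} \<and> {i. p i \<noteq> []} \<subseteq> K}"

definition cohen_product_le :: "('k \<Rightarrow> cohen_cond) \<Rightarrow> ('k \<Rightarrow> cohen_cond) \<Rightarrow> bool" where
  "cohen_product_le q p \<longleftrightarrow> (\<forall>i. cohen_le (q i) (p i))"

text \<open>
  Cardinals \<open>\<kappa>\<close> are represented as cardinal orders on (sub)sets of a type \<open>'k\<close>; the copies of Cohen
  forcing are indexed by the elements of \<open>\<kappa>\<close>.
\<close>
definition cohen_witness ::
    "'k rel \<Rightarrow> (nat \<Rightarrow> nat set) \<Rightarrow> nat set set \<Rightarrow> bool" where
  "cohen_witness \<kappa> C A \<longleftrightarrow>
     forcing_notion.forces_witnesses_non_fi (cohen_product (Field \<kappa>)) cohen_product_le C A"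

text \<open>
  A statement of the form ``there are \<open>A\<close> and \<open>C\<close> such that for every cardinal \<open>\<kappa>\<close>'' has to
  quantify over cardinals on arbitrary types inside the existential quantifier.  A free type
  variable \<open>'k\<close> alone would allow \<open>A\<close> and \<open>C\<close> to depend on it.  The following pair is a single
  object that does not depend on any type variable; requiring \<open>(A, C)\<close> to be this pair excludes
  such a dependence.
\<close>
definition uniform_pair :: "nat set set \<times> (nat \<Rightarrow> nat set)" where
  "uniform_pair = (SOME (A, C).
     mad A \<and> \<not> fin_intersecting A \<and>
     forcing_notion.forces_mad_non_fi cohen cohen_le A \<and>
     witnesses_non_fi C A \<and>
     (\<forall>\<kappa> :: nat rel. Card_order \<kappa> \<longrightarrow> cohen_witness \<kappa> C A))"

end

theory Submission
  imports Defs "HOL-Library.Countable_Set" "HOL-Library.Nat_Bijection"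
begin

text \<open>
  Let \<open>C n\<close> be the \<open>n\<close>-th block of a partition of \<open>\<omega>\<close> into sets of size \<open>n + 1\<close>.  Only sets that
  meet every block in at most one point are put into \<open>A\<close>; thus finitely many of them never
  cover a block with a large index, and \<open>C n\<close> always has room for a new point.  Under CH there
  are \<open>\<omega>\<^sub>1\<close> countable lists of subsets of \<open>\<omega>\<close>.  For each of them a recursion of length \<open>\<omega>\<^sub>1\<close> adds two
  sets \<open>a\<close>, \<open>b\<close> which touch disjoint sets of blocks and such that both meet every positive set on
  the list, and every union of infinitely many blocks whose index set is on the list,
  infinitely often.

  If a name \<open>x\<close> for a subset of \<open>\<omega>\<close> is given and the forcing is countable, the sets
  \<open>{n. some r \<preceq> q forces n \<in> x}\<close>, for \<open>q\<close> below a given condition, form such a list.  A set that meets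
  each of them infinitely often is forced to meet \<open>x\<close> infinitely often.  This yields
  maximality as well as the two traces with empty intersection.  For uncountably many Cohen reals, a
  closing-off argument reduces a name to countably many coordinates.  It applies to every
  \<open>A\<close> and \<open>C\<close> that work for the countable products, in particular to the pair picked by
  \<^const>\<open>uniform_pair\<close>.
\<close>

section \<open>A tight family of partial selectors\<close>

definition block :: "nat \<Rightarrow> nat" where
  "block k = fst (prod_decode k) + snd (prod_decode k)"

text \<open>The blocks are the diagonals of the pairing function, so their sizes grow by one from
  each block to the next.\<close>

lemma block_fibre: "block -` {n} = (\<lambda>i. prod_encode (i, n - i)) ` {..n}"
proof (intro set_eqI iffI)
  fix k assume "k \<in> block -` {n}"
  then show "k \<in> (\<lambda>i. prod_encode (i, n - i)) ` {..n}"
    by (intro image_eqI[where x = "fst (prod_decode k)"]) (auto simp: block_def)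
qed (auto simp: block_def)

lemma finite_block_fibre: "finite (block -` {n})"
  by (simp add: block_fibre)

lemma card_block_fibre: "card (block -` {n}) = Suc n"
  unfolding block_fibre by (subst card_image) (auto simp: inj_on_def prod_encode_eq)

lemma finite_block_le: "finite {k. block k \<le> n}"
proof -
  have "{k. block k \<le> n} = (\<Union>m\<in>{..n}. block -` {m})" by auto
  then show ?thesis by (simp add: finite_block_fibre)
qed

lemma fin_seq_block: "fin_seq (\<lambda>n. block -` {n})"
  unfolding fin_seq_def
proof (intro conjI allI impI)
  show "block -` {n} \<noteq> {}" for n
    using card_block_fibre[of n] by (metis card.empty nat.distinct(1))
qed (auto simp: finite_block_fibre)

definition selector_ad :: "nat set set \<Rightarrow> bool" where
  "selector_ad B \<longleftrightarrow> (\<forall>a\<in>B. infinite a \<and> inj_on block a) \<and>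
     (\<forall>a\<in>B. \<forall>b\<in>B. a \<noteq> b \<longrightarrow> finite (a \<inter> b))"

text \<open>Positivity for the ideal generated by \<open>B\<close> and the finite sets.\<close>

definition positive :: "nat set set \<Rightarrow> nat set \<Rightarrow> bool" where
  "positive B Y \<longleftrightarrow> (\<forall>F. finite F \<and> F \<subseteq> B \<longrightarrow> infinite (Y - \<Union>F))"

lemma positive_mono: "positive B Y \<Longrightarrow> B' \<subseteq> B \<Longrightarrow> positive B' Y"
  unfolding positive_def by blast

text \<open>A finite \<open>F\<close> of selectors takes at most \<open>card F\<close> points from a
  block, and the block with index n has n + 1 points. So every block of index at least
  \<open>card F\<close> keeps a point outside \<Union>F.\<close>

lemma positive_block_vimage:
  assumes B: "selector_ad B" and X: "infinite X"
  shows "positive B (block -` X)"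
  unfolding positive_def
proof (intro allI impI, elim conjE)
  fix F assume F: "finite F" "F \<subseteq> B"
  have "X - {..<card F} \<subseteq> block ` (block -` X - \<Union>F)"
  proof
    fix n assume n: "n \<in> X - {..<card F}"
    have one: "card (block -` {n} \<inter> a) \<le> 1" if "a \<in> F" for a
    proof -
      have "inj_on block a" using that F B by (auto simp: selector_ad_def)
      then have "x = y" if "x \<in> block -` {n} \<inter> a" "y \<in> block -` {n} \<inter> a" for x y
        using that by (auto dest: inj_onD)
      then show ?thesis by (simp add: card_le_Suc0_iff_eq finite_block_fibre)
    qed
    have "card (block -` {n} \<inter> \<Union>F) = card (\<Union>a\<in>F. block -` {n} \<inter> a)"
      by (rule arg_cong[where f = card]) auto
    also have "\<dots> \<le> (\<Sum>a\<in>F. card (block -` {n} \<inter> a))" by (rule card_UN_le[OF F(1)])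
    also have "\<dots> \<le> (\<Sum>a\<in>F. 1)" by (rule sum_mono) (rule one)
    also have "\<dots> < card (block -` {n})" using n by (simp add: card_block_fibre)
    finally have "\<not> block -` {n} \<subseteq> \<Union>F" by (auto simp: Int_absorb2)
    then obtain k where "block k = n" "k \<notin> \<Union>F" by auto
    then show "n \<in> block ` (block -` X - \<Union>F)" using n by blast
  qed
  moreover have "infinite (X - {..<card F})" using X by simp
  ultimately show "infinite (block -` X - \<Union>F)"
    using finite_surj by blast
qed

lemma selector_ad_insert:
  assumes "selector_ad B" "infinite a" "inj_on block a" "\<And>b. b \<in> B \<Longrightarrow> finite (a \<inter> b)"
  shows "selector_ad (insert a B)"
  using assms by (auto simp: selector_ad_def Int_commute)

text \<open>A sequence \<open>x\<close> is chosen with strictly increasing block index. Its k-th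
  term lies in the positive set scheduled for k and avoids the first k sets in the enumeration of
  \<open>B\<close>. The terms of even index form a, those of odd index form b; since no block is
  used twice, both are selectors and they touch disjoint sets of blocks.\<close>

lemma selector_extension:
  assumes B: "selector_ad B" "countable B"
    and Y: "countable \<Y>" "\<And>Y. Y \<in> \<Y> \<Longrightarrow> positive B Y"
  obtains a b where "selector_ad (B \<union> {a, b})" "block ` a \<inter> block ` b = {}"
    "\<And>Y. Y \<in> \<Y> \<Longrightarrow> infinite (a \<inter> Y) \<and> infinite (b \<inter> Y)"
proof -
  \<comment> \<open>Adding \<open>{}\<close> provides a nonempty range even when \<open>B\<close> is
    empty, and avoiding \<open>{}\<close> costs nothing.\<close>
  define enB where "enB = from_nat_into (insert {} B)"
  have enB: "range enB = insert {} B"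
    unfolding enB_def by (rule range_from_nat_into) (use B in auto)
  \<comment> \<open>\<open>UNIV\<close> is positive as well, and meeting it infinitely often makes a
    and b infinite.\<close>
  define enY where "enY = from_nat_into (insert UNIV \<Y>)"
  have enY: "range enY = insert UNIV \<Y>"
    unfolding enY_def by (rule range_from_nat_into) (use Y in auto)
  \<comment> \<open>Every index is scheduled at infinitely many even and at infinitely many odd
    places.\<close>
  define t where "t k = fst (prod_decode (k div 2))" for k :: nat
  have "positive B UNIV" using positive_block_vimage[OF B(1), of UNIV] by simp
  then have pos: "positive B (enY i)" for i
    using Y(2) enY by (metis insertE rangeI)
  have step: "\<exists>y. (y \<in> enY (t k) \<and> (\<forall>j<k. y \<notin> enB j)) \<and> block y > N" for k N
  proof -
    define F where "F = enB ` {..<k} - {{}}"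
    have "finite F" "F \<subseteq> B" using enB by (auto simp: F_def)
    then have "infinite (enY (t k) - \<Union>F)" using pos[of "t k"] by (auto simp: positive_def)
    \<comment> \<open>Only finitely many points lie in the blocks of index at most
      \<open>N\<close>.\<close>
    then have "\<not> enY (t k) - \<Union>F \<subseteq> {y. block y \<le> N}" using finite_block_le finite_subset by blast
    then show ?thesis by (force simp: F_def not_le)
  qed
  have "\<exists>x. \<forall>k. (x k \<in> enY (t k) \<and> (\<forall>j<k. x k \<notin> enB j)) \<and> block (x k) < block (x (Suc k))"
  proof (rule dependent_nat_choice)
    show "\<exists>x. x \<in> enY (t 0) \<and> (\<forall>j<0. x \<notin> enB j)" using step[of 0] by blast
    show "\<exists>y. (y \<in> enY (t (Suc k)) \<and> (\<forall>j<Suc k. y \<notin> enB j)) \<and> block x < block y" for x k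
      by (rule step)
  qed
  then obtain x where x: "\<And>k. x k \<in> enY (t k)" "\<And>j k. j < k \<Longrightarrow> x k \<notin> enB j"
    and "\<And>k. block (x k) < block (x (Suc k))"
    by metis
  then have "strict_mono (\<lambda>k. block (x k))" by (simp add: strict_mono_Suc_iff)
  then have inj: "inj (\<lambda>k. block (x k))" by (rule strict_mono_imp_inj_on)
  then have injx: "inj x" by (auto simp: inj_on_def)
  have meets: "infinite (x ` {k. even k = e} \<inter> Y)" if "Y \<in> insert UNIV \<Y>" for Y e
  proof -
    have "Y \<in> range enY" using that by (simp add: enY)
    then obtain i where i: "Y = enY i" by blast
    \<comment> \<open>\<open>g\<close> runs injectively through places of the parity given by
      \<open>e\<close> at which \<open>enY i\<close> is scheduled.\<close>
    define g where "g m = 2 * prod_encode (i, m) + (if e then 0 else 1)" for m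
    have "inj g" by (auto simp: inj_on_def g_def prod_encode_eq)
    then have "inj (x \<circ> g)" using injx inj_compose by blast
    then have "infinite (range (x \<circ> g))" using finite_imageD infinite_UNIV_nat by blast
    moreover have "even (g m) = e" "t (g m) = i" for m by (auto simp: g_def t_def)
    then have "(x \<circ> g) m \<in> x ` {k. even k = e} \<inter> Y" for m
      using x(1)[of "g m"] i by auto
    then have "range (x \<circ> g) \<subseteq> x ` {k. even k = e} \<inter> Y" by blast
    ultimately show ?thesis using finite_subset by blast
  qed
  have ad: "finite (x ` S \<inter> b)" if "b \<in> B" for b S
  proof -
    have "b \<in> range enB" using that by (simp add: enB)
    then obtain j where "b = enB j" by blast
    \<comment> \<open>The term x k avoids all sets enumerated before place k, so only x 0, ..., x j
      can lie in \<open>enB j\<close>.\<close>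
    then have "x ` S \<inter> b \<subseteq> x ` {..j}" using x(2) by (auto simp: image_iff not_le[symmetric])
    then show ?thesis by (rule finite_subset) simp
  qed
  have inf: "infinite (x ` {k. even k = e})" for e using meets[of UNIV e] by simp
  have sel: "inj_on block (x ` S)" for S using inj by (auto simp: inj_on_def)
  have disj: "block ` x ` {k. even k = True} \<inter> block ` x ` {k. even k = False} = {}"
    using inj by (auto dest: injD)
  then have disj': "x ` {k. even k = True} \<inter> x ` {k. even k = False} = {}" by blast
  have "selector_ad (insert (x ` {k. even k = False}) B)"
    by (rule selector_ad_insert[OF B(1) inf sel ad])
  then have "selector_ad (insert (x ` {k. even k = True}) (insert (x ` {k. even k = False}) B))"
    by (rule selector_ad_insert[OF _ inf sel]) (use ad disj' in auto)
  then have "selector_ad (B \<union> {x ` {k. even k = True}, x ` {k. even k = False}})"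
    by (simp add: insert_commute)
  then show ?thesis
  proof (rule that[OF _ disj])
    show "infinite (x ` {k. even k = True} \<inter> Y) \<and> infinite (x ` {k. even k = False} \<inter> Y)"
      if "Y \<in> \<Y>" for Y
      using meets[of Y True] meets[of Y False] that by blast
  qed
qed

text \<open>This coding lets the recursion below run along a well-order of \<^typ>\<open>nat set\<close>.\<close>
definition decode :: "nat set \<Rightarrow> nat \<Rightarrow> nat set" where
  "decode s i = {n. prod_encode (i, n) \<in> s}"

lemma decode_surj: "\<exists>s. decode s = X"
proof
  show "decode {k. snd (prod_decode k) \<in> X (fst (prod_decode k))} = X"
    by (auto simp: decode_def)
qed

text \<open>Under CH the cardinal order of the power set of \<omega> has order type
  \<open>\<omega>\<^sub>1\<close>: a proper initial segment has cardinality below the successor of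
  \<aleph>_0, hence is countable.\<close>

lemma CH_wellorder:
  assumes continuum_hypothesis
  obtains r :: "nat set rel" where "wf (r - Id)" "Well_order r" "Field r = UNIV"
    "\<And>s. countable (underS r s)"
proof
  let ?r = "card_of (UNIV :: nat set set)"
  show W: "Well_order ?r" by (rule card_of_Well_order)
  then show "wf (?r - Id)" by (simp add: well_order_on_def)
  show F: "Field ?r = UNIV" by (rule Field_card_of)
  fix s
  have "(card_of (underS ?r s), ?r) \<in> ordLess"
    by (rule card_of_underS[OF card_of_Card_order]) (simp add: F)
  then have "(card_of (underS ?r s), cardSuc natLeq) \<in> ordLess"
    using assms unfolding continuum_hypothesis_def by (rule ordLess_ordIso_trans)
  then have "(card_of (underS ?r s), natLeq) \<in> ordLeq"
    by (simp only: cardSuc_ordLeq_ordLess[OF natLeq_Card_order card_of_Card_order])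
  then have "(card_of (underS ?r s), card_of (UNIV :: nat set)) \<in> ordLeq"
    by (rule ordLeq_ordIso_trans[OF _ ordIso_symmetric[OF card_of_nat]])
  then obtain f :: "nat set \<Rightarrow> nat" where "inj_on f (underS ?r s)"
    unfolding card_of_ordLeq[symmetric] by blast
  then show "countable (underS ?r s)" by (rule countableI)
qed

text \<open>Stage s of a recursion along the well-order treats the list coded by s. Only countably
  many sets have been added before, so \<open>selector_extension\<close> applies. A set that is
  positive for the final family is positive for the family of every stage, so it was met when the
  code of its list was treated.\<close>

lemma tight_family_exists:
  assumes continuum_hypothesis
  obtains A where "selector_ad A"
    "\<And>X :: nat \<Rightarrow> nat set. (\<And>i. positive A (X i)) \<Longrightarrow> \<exists>a\<in>A. \<forall>i. infinite (a \<inter> X i)"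
    "\<And>X :: nat \<Rightarrow> nat set. (\<And>i. infinite (X i)) \<Longrightarrow> \<exists>a\<in>A. \<exists>b\<in>A. block ` a \<inter> block ` b = {} \<and>
       (\<forall>i. infinite (block ` a \<inter> X i) \<and> infinite (block ` b \<inter> X i))"
proof -
  obtain r :: "nat set rel" where r: "wf (r - Id)" "Well_order r" "Field r = UNIV"
    and cnt: "\<And>s. countable (underS r s)"
    using CH_wellorder[OF assms] by blast
  \<comment> \<open>\<open>E\<close> is what stage \<open>s\<close> adds to the sets
    \<open>B\<close> of the earlier stages. Both requirements are conditional, so that every code
    can be treated, whatever sets its list contains.\<close>
  define ok where "ok B s E \<longleftrightarrow> countable E \<and> selector_ad (B \<union> E) \<and>
      (\<exists>a\<in>E. \<exists>b\<in>E. block ` a \<inter> block ` b = {} \<and>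
        (\<forall>i. (positive B (decode s i) \<longrightarrow> infinite (a \<inter> decode s i)) \<and>
          (infinite (decode s i) \<longrightarrow> infinite (a \<inter> block -` decode s i) \<and> infinite (b \<inter> block -` decode s i))))"
    for B s E
  have ok_ex: "\<exists>E. ok B s E" if B: "selector_ad B" "countable B" for B s
  proof -
    \<comment> \<open>The unions of blocks over infinite index sets belong to \<Y> by
      \<open>positive_block_vimage\<close>.\<close>
    define \<Y> where "\<Y> = {Y. positive B Y} \<inter> (range (decode s) \<union> range (\<lambda>i. block -` decode s i))"
    have "countable \<Y>" unfolding \<Y>_def by (intro countable_Int2 countable_Un) auto
    moreover have "\<And>Y. Y \<in> \<Y> \<Longrightarrow> positive B Y" by (auto simp: \<Y>_def)
    ultimately obtain a b where ab: "selector_ad (B \<union> {a, b})" "block ` a \<inter> block ` b = {}"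
      "\<And>Y. Y \<in> \<Y> \<Longrightarrow> infinite (a \<inter> Y) \<and> infinite (b \<inter> Y)"
      using selector_extension[OF B] by metis
    have "infinite (a \<inter> decode s i)" if "positive B (decode s i)" for i
      using ab(3)[of "decode s i"] that by (simp add: \<Y>_def)
    moreover have "infinite (a \<inter> block -` decode s i) \<and> infinite (b \<inter> block -` decode s i)"
      if "infinite (decode s i)" for i
      using ab(3)[of "block -` decode s i"] positive_block_vimage[OF B(1) that] by (simp add: \<Y>_def)
    ultimately have "block ` a \<inter> block ` b = {} \<and>
        (\<forall>i. (positive B (decode s i) \<longrightarrow> infinite (a \<inter> decode s i)) \<and>
          (infinite (decode s i) \<longrightarrow> infinite (a \<inter> block -` decode s i) \<and> infinite (b \<inter> block -` decode s i)))"
      using ab(2) by simp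
    then have "ok B s {a, b}"
      unfolding ok_def using ab(1) by (intro conjI bexI[of _ a] bexI[of _ b]) auto
    then show ?thesis by blast
  qed
  \<comment> \<open>The choice is meaningful only if a suitable set exists; this is shown afterwards
    by induction along the well-order.\<close>
  define f where "f = wfrec (r - Id) (\<lambda>f s. SOME E. ok (\<Union>t\<in>underS r s. f t) s E)"
  define U where "U s = (\<Union>t\<in>underS r s. f t)" for s
  have f: "f s = (SOME E. ok (U s) s E)" for s
  proof -
    \<comment> \<open>\<open>wfrec\<close> cuts its argument off outside the strict predecessors of
      s. The union runs over exactly these, so the cut changes nothing.\<close>
    have "(\<Union>t\<in>underS r s. cut f (r - Id) s t) = U s"
      unfolding U_def by (intro SUP_cong refl cut_apply) (auto simp: underS_def)
    then show ?thesis by (simp add: def_wfrec[OF eq_reflection[OF f_def] r(1)])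
  qed
  have trans: "trans r" and total: "\<And>s t. s \<noteq> t \<Longrightarrow> (s, t) \<in> r \<or> (t, s) \<in> r" and anti: "antisym r"
    using r(2,3) by (auto simp: order_on_defs total_on_def)
  \<comment> \<open>The stages increase along r, so two members of the union lie in a common stage,
    and \<open>selector_ad\<close> speaks of at most two members at a time.\<close>
  have chain: "selector_ad (\<Union>t\<in>T. U t \<union> f t)" if "\<And>t. t \<in> T \<Longrightarrow> selector_ad (U t \<union> f t)" for T
  proof -
    have incl: "U t \<union> f t \<subseteq> U t' \<union> f t'" if "(t, t') \<in> r" "t \<noteq> t'" for t t'
    proof -
      have "underS r t \<subseteq> underS r t'" "t \<in> underS r t'"
        using that trans anti by (auto simp: underS_def dest: transD antisymD)
      then show ?thesis unfolding U_def by blast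
    qed
    have "\<exists>t''\<in>T. a \<in> U t'' \<union> f t'' \<and> b \<in> U t'' \<union> f t''"
      if ab: "a \<in> (\<Union>t\<in>T. U t \<union> f t)" "b \<in> (\<Union>t\<in>T. U t \<union> f t)" for a b
    proof -
      obtain t t' where t: "t \<in> T" "t' \<in> T" "a \<in> U t \<union> f t" "b \<in> U t' \<union> f t'" using ab by blast
      consider "t = t'" | "t \<noteq> t'" "(t, t') \<in> r" | "t \<noteq> t'" "(t', t) \<in> r"
        using total[of t t'] by blast
      then show ?thesis
      proof cases
        case 2 then show ?thesis using incl[of t t'] t by blast
      next
        case 3 then show ?thesis using incl[of t' t] t by blast
      qed (use t in blast)
    qed
    then have "(infinite a \<and> inj_on block a) \<and> (a \<noteq> b \<longrightarrow> finite (a \<inter> b))"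
      if "a \<in> (\<Union>t\<in>T. U t \<union> f t)" "b \<in> (\<Union>t\<in>T. U t \<union> f t)" for a b
      using that \<open>\<And>t. t \<in> T \<Longrightarrow> selector_ad (U t \<union> f t)\<close> unfolding selector_ad_def by meson
    then show ?thesis unfolding selector_ad_def by blast
  qed
  \<comment> \<open>This gives the family before stage s the shape that \<open>chain\<close> treats:
    a union of completed stages.\<close>
  have U_eq: "U s = (\<Union>t\<in>underS r s. U t \<union> f t)" for s
  proof -
    have "underS r t \<subseteq> underS r s" if "t \<in> underS r s" for t
      using that trans anti by (auto simp: underS_def dest: transD antisymD)
    then show ?thesis unfolding U_def by blast
  qed
  have ok: "ok (U s) s (f s) \<and> countable (f s)" for s
    using r(1)
  proof (induction s rule: wf_induct_rule)
    case (less s)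
    then have IH: "ok (U t) t (f t) \<and> countable (f t)" if "t \<in> underS r s" for t
      using that by (auto simp: underS_def)
    have "selector_ad (U s)"
      by (subst U_eq, rule chain) (use IH in \<open>auto simp: ok_def\<close>)
    moreover have "countable (U s)" unfolding U_def by (rule countable_UN[OF cnt]) (use IH in auto)
    ultimately have "ok (U s) s (f s)" unfolding f by (rule someI_ex[OF ok_ex])
    then show ?case by (simp add: ok_def)
  qed
  define A where "A = (\<Union>t. U t \<union> f t)"
  have sub: "U s \<subseteq> A" "f s \<subseteq> A" for s by (auto simp: A_def)
  have A: "selector_ad A" unfolding A_def by (rule chain) (use ok in \<open>auto simp: ok_def\<close>)
  show ?thesis
  proof (rule that[OF A])
    fix X :: "nat \<Rightarrow> nat set" assume X: "\<And>i. positive A (X i)"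
    obtain s where s: "decode s = X" using decode_surj by blast
    obtain a where "a \<in> f s" "\<forall>i. positive (U s) (X i) \<longrightarrow> infinite (a \<inter> X i)"
      using ok[of s] unfolding ok_def s by meson
    moreover have "positive (U s) (X i)" for i using X sub(1) by (rule positive_mono)
    ultimately show "\<exists>a\<in>A. \<forall>i. infinite (a \<inter> X i)" using sub(2) by blast
  next
    fix X :: "nat \<Rightarrow> nat set" assume X: "\<And>i. infinite (X i)"
    obtain s where s: "decode s = X" using decode_surj by blast
    obtain a b where ab: "a \<in> f s" "b \<in> f s" "block ` a \<inter> block ` b = {}"
      "\<forall>i. infinite (X i) \<longrightarrow> infinite (a \<inter> block -` X i) \<and> infinite (b \<inter> block -` X i)"
      using ok[of s] unfolding ok_def s by meson
    \<comment> \<open>A selector has at most one point in each block, so infinitely many of its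
      points in these blocks touch infinitely many of them.\<close>
    have "infinite (block ` c \<inter> X i)" if "c \<in> A" "infinite (c \<inter> block -` X i)" for c i
    proof -
      have "inj_on block (c \<inter> block -` X i)"
        using A \<open>c \<in> A\<close> by (auto simp: selector_ad_def intro: inj_on_subset)
      then have "infinite (block ` (c \<inter> block -` X i))" using that finite_imageD by blast
      moreover have "block ` (c \<inter> block -` X i) = block ` c \<inter> X i" by auto
      ultimately show ?thesis by simp
    qed
    moreover have "a \<in> A" "b \<in> A" using ab sub(2)[of s] by auto
    ultimately show "\<exists>a\<in>A. \<exists>b\<in>A. block ` a \<inter> block ` b = {} \<and>
       (\<forall>i. infinite (block ` a \<inter> X i) \<and> infinite (block ` b \<inter> X i))"
      using ab(3,4) X by (intro bexI[of _ a] bexI[of _ b]) auto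
  qed
qed

section \<open>Semantics of the forcing relation\<close>

text \<open>The trace of a on I is \<open>touch C a \<inter> I\<close>. This separates a
  ground-model set from I, which is only a name when the extension is discussed.\<close>

definition touch :: "(nat \<Rightarrow> nat set) \<Rightarrow> nat set \<Rightarrow> nat set" where
  "touch C a = {n. a \<inter> C n \<noteq> {}}"

section \<open>Regular predicates on the conditions of a preordered forcing\<close>

locale preorder_forcing = forcing_notion P le for P :: "'p set" and le :: "'p \<Rightarrow> 'p \<Rightarrow> bool" (infix \<open>\<preceq>\<close> 50) +
  assumes refl [simp]: "p \<preceq> p" and trans [trans]: "p \<preceq> q \<Longrightarrow> q \<preceq> r \<Longrightarrow> p \<preceq> r"
begin

text \<open>Regular predicates correspond to regular open sets of conditions, as forced statements
  do. Eliminating a forced implication relies on this property.\<close>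

definition regular :: "'p prp \<Rightarrow> bool" where
  "regular \<phi> \<longleftrightarrow> (\<forall>p\<in>P. \<phi> p \<longleftrightarrow> (\<forall>q\<in>P. q \<preceq> p \<longrightarrow> (\<exists>r\<in>P. r \<preceq> q \<and> \<phi> r)))"

lemma regular_down: "regular \<phi> \<Longrightarrow> p \<in> P \<Longrightarrow> \<phi> p \<Longrightarrow> q \<in> P \<Longrightarrow> q \<preceq> p \<Longrightarrow> \<phi> q"
  unfolding regular_def by (meson trans)

lemma regular_dense:
  assumes "regular \<phi>" "p \<in> P" "\<And>q. q \<in> P \<Longrightarrow> q \<preceq> p \<Longrightarrow> \<exists>r\<in>P. r \<preceq> q \<and> \<phi> r"
  shows "\<phi> p"
  using assms unfolding regular_def by blast

lemma regularI:
  assumes "\<And>p q. p \<in> P \<Longrightarrow> \<phi> p \<Longrightarrow> q \<in> P \<Longrightarrow> q \<preceq> p \<Longrightarrow> \<phi> q"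
    and "\<And>p. p \<in> P \<Longrightarrow> (\<And>q. q \<in> P \<Longrightarrow> q \<preceq> p \<Longrightarrow> \<exists>r\<in>P. r \<preceq> q \<and> \<phi> r) \<Longrightarrow> \<phi> p"
  shows "regular \<phi>"
  unfolding regular_def using assms refl by meson

text \<open>The finitely many requirements are met one after the other; each is preserved under
  strengthening, so later steps do not destroy earlier ones.\<close>

lemma finite_dense:
  assumes "finite S" "p \<in> P"
    and "\<And>x q. x \<in> S \<Longrightarrow> q \<in> P \<Longrightarrow> q \<preceq> p \<Longrightarrow> \<exists>r\<in>P. r \<preceq> q \<and> D x r"
    and "\<And>x q r. x \<in> S \<Longrightarrow> q \<in> P \<Longrightarrow> D x q \<Longrightarrow> r \<in> P \<Longrightarrow> r \<preceq> q \<Longrightarrow> D x r"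
  shows "\<exists>r\<in>P. r \<preceq> p \<and> (\<forall>x\<in>S. D x r)"
  using assms(1,3,4)
proof (induction S)
  case empty
  show ?case using assms(2) refl by blast
next
  case (insert x S)
  have "\<exists>r\<in>P. r \<preceq> p \<and> (\<forall>x\<in>S. D x r)"
    by (rule insert.IH) (use insert.prems in blast)+
  then obtain r where r: "r \<in> P" "r \<preceq> p" "\<forall>x\<in>S. D x r" by blast
  obtain s where s: "s \<in> P" "s \<preceq> r" "D x s" using insert.prems(1)[OF _ r(1,2)] by blast
  have "D y s" if "y \<in> S" for y using insert.prems(2)[OF _ r(1) _ s(1,2)] r(3) that by blast
  moreover have "s \<preceq> p" using s(2) r(2) by (rule trans)
  ultimately show ?case using s by blast
qed

lemma regular_ground [intro!, simp]: "regular \<lbrakk>b\<rbrakk>"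
  unfolding regular_def ground_def using refl by blast

lemma regular_fnot [intro!, simp]: "regular \<phi> \<Longrightarrow> regular (\<^bold>\<not> \<phi>)"
proof (rule regularI)
  assume \<phi>: "regular \<phi>"
  show "(\<^bold>\<not> \<phi>) q" if "(\<^bold>\<not> \<phi>) p" "q \<preceq> p" for p q
    using that trans unfolding fnot_def by blast
  show "(\<^bold>\<not> \<phi>) p" if dense: "\<And>q. q \<in> P \<Longrightarrow> q \<preceq> p \<Longrightarrow> \<exists>r\<in>P. r \<preceq> q \<and> (\<^bold>\<not> \<phi>) r" for p
    unfolding fnot_def
  proof (intro ballI impI notI)
    fix q assume q: "q \<in> P" "q \<preceq> p" "\<phi> q"
    then obtain r where "r \<in> P" "r \<preceq> q" "(\<^bold>\<not> \<phi>) r" using dense by blast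
    then show False using regular_down[OF \<phi>, of q r] q refl[of r] unfolding fnot_def by blast
  qed
qed

lemma regular_fconj [intro!, simp]: "regular \<phi> \<Longrightarrow> regular \<psi> \<Longrightarrow> regular (\<phi> \<^bold>\<and> \<psi>)"
proof (rule regularI)
  assume r: "regular \<phi>" "regular \<psi>"
  show "(\<phi> \<^bold>\<and> \<psi>) q" if "p \<in> P" "(\<phi> \<^bold>\<and> \<psi>) p" "q \<in> P" "q \<preceq> p" for p q
    using that r regular_down unfolding fconj_def by blast
  show "(\<phi> \<^bold>\<and> \<psi>) p" if "p \<in> P" "\<And>q. q \<in> P \<Longrightarrow> q \<preceq> p \<Longrightarrow> \<exists>r\<in>P. r \<preceq> q \<and> (\<phi> \<^bold>\<and> \<psi>) r" for p
    unfolding fconj_def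
  proof
    show "\<phi> p" by (rule regular_dense[OF r(1)]) (use that in \<open>auto simp: fconj_def\<close>)
    show "\<psi> p" by (rule regular_dense[OF r(2)]) (use that in \<open>auto simp: fconj_def\<close>)
  qed
qed

lemma regular_fall [intro!, simp]:
  assumes "\<And>x. regular (\<phi> x)"
  shows "regular (\<^bold>\<forall>x. \<phi> x)"
proof (rule regularI)
  show "(\<^bold>\<forall>x. \<phi> x) q" if "p \<in> P" "(\<^bold>\<forall>x. \<phi> x) p" "q \<in> P" "q \<preceq> p" for p q
    using that assms regular_down unfolding fall_def by blast
  show "(\<^bold>\<forall>x. \<phi> x) p" if "p \<in> P" "\<And>q. q \<in> P \<Longrightarrow> q \<preceq> p \<Longrightarrow> \<exists>r\<in>P. r \<preceq> q \<and> (\<^bold>\<forall>x. \<phi> x) r" for p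
    unfolding fall_def
  proof
    show "\<phi> x p" for x by (rule regular_dense[OF assms]) (use that in \<open>auto simp: fall_def\<close>)
  qed
qed

lemma regular_fimp [intro!, simp]: "regular \<phi> \<Longrightarrow> regular \<psi> \<Longrightarrow> regular (\<phi> \<^bold>\<longrightarrow> \<psi>)"
  by (simp add: fimp_def)

lemma regular_fiff [intro!, simp]: "regular \<phi> \<Longrightarrow> regular \<psi> \<Longrightarrow> regular (\<phi> \<^bold>\<longleftrightarrow> \<psi>)"
  by (simp add: fiff_def)

lemma regular_fex [intro!, simp]: "(\<And>x. regular (\<phi> x)) \<Longrightarrow> regular (\<^bold>\<exists>x. \<phi> x)"
  by (simp add: fex_def)

text \<open>Membership is itself defined by density, hence regular whatever \<open>E\<close>
  is.\<close>

lemma regular_mem [intro!, simp]: "regular (mem E x X)"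
proof (rule regularI)
  show "mem E x X q" if "mem E x X p" "q \<preceq> p" for p q
    using that trans unfolding mem_def by blast
  show "mem E x X p" if dense: "\<And>q. q \<in> P \<Longrightarrow> q \<preceq> p \<Longrightarrow> \<exists>r\<in>P. r \<preceq> q \<and> mem E x X r" for p
    unfolding mem_def
  proof (intro ballI impI)
    fix q assume "q \<in> P" "q \<preceq> p"
    then obtain r where r: "r \<in> P" "r \<preceq> q" "mem E x X r" using dense by blast
    then obtain s where "s \<in> P" "s \<preceq> r" "\<exists>(y, t)\<in>X. t \<in> P \<and> s \<preceq> t \<and> E x y s"
      unfolding mem_def using refl by blast
    then show "\<exists>r\<in>P. r \<preceq> q \<and> (\<exists>(y, s)\<in>X. s \<in> P \<and> r \<preceq> s \<and> E x y r)"
      using r trans by blast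
  qed
qed

lemma regular_names [intro!, simp]:
  "regular (nat_eq n m)" "regular (n \<^bold>\<in> x)" "regular (x \<^bold>= y)" "regular (x \<^bold>\<in>\<^bold>\<in> X)"
  by (simp_all add: nat_eq_def nat_mem_def real_eq_def real_mem_def)

lemma regular_fin [intro!, simp]:
  assumes "\<And>x y. regular (E x y)" "\<And>x. regular (\<phi> x)"
  shows "regular (fin E \<phi>)"
  using assms by (simp add: fin_def)

lemma regular_derived [intro!, simp]:
  "regular (family_subset X Y)" "regular (fin_family X)"
  "(\<And>n. regular (\<psi> n)) \<Longrightarrow> regular (fin_nats \<psi>)"
  by (simp_all add: family_subset_def fin_family_def fin_nats_def)

lemma regular_traces_ext [intro!, simp]: "regular (traces_ext I C X x)"
  by (simp add: traces_ext_def)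

lemma regular_centered_ext [intro!, simp]:
  "(\<And>x. regular (\<phi> x)) \<Longrightarrow> regular (centered_ext \<phi>)"
  by (simp add: centered_ext_def)

lemma regular_fin_seq_ext [intro!, simp]: "regular (fin_seq_ext C)"
  by (simp add: fin_seq_ext_def)

section \<open>Rules for the forced connectives and for names\<close>

lemma fnotI: "(\<And>q. q \<in> P \<Longrightarrow> q \<preceq> p \<Longrightarrow> \<phi> q \<Longrightarrow> False) \<Longrightarrow> (\<^bold>\<not> \<phi>) p"
  unfolding fnot_def by blast

lemma fnotD: "(\<^bold>\<not> \<phi>) p \<Longrightarrow> q \<in> P \<Longrightarrow> q \<preceq> p \<Longrightarrow> \<not> \<phi> q"
  unfolding fnot_def by blast

lemma not_fnotE:
  assumes "\<not> (\<^bold>\<not> \<phi>) p"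
  obtains q where "q \<in> P" "q \<preceq> p" "\<phi> q"
  using assms unfolding fnot_def by blast

lemma fimpI: "(\<And>q. q \<in> P \<Longrightarrow> q \<preceq> p \<Longrightarrow> \<phi> q \<Longrightarrow> \<psi> q) \<Longrightarrow> (\<phi> \<^bold>\<longrightarrow> \<psi>) p"
  unfolding fimp_def fnot_def fconj_def using refl by blast

text \<open>A forced implication is a negated conjunction and yields \<psi> only densely below q.
  Regularity of \<phi> carries the premise down to these conditions, regularity of \<psi> lifts the
  conclusion back to q.\<close>

lemma fimpD:
  assumes "(\<phi> \<^bold>\<longrightarrow> \<psi>) p" "q \<in> P" "q \<preceq> p" "\<phi> q" "regular \<phi>" "regular \<psi>"
  shows "\<psi> q"
proof (rule regular_dense[OF assms(6,2)])
  fix r assume r: "r \<in> P" "r \<preceq> q"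
  then have "\<phi> r" "r \<preceq> p" using assms regular_down trans by blast+
  then show "\<exists>s\<in>P. s \<preceq> r \<and> \<psi> s"
    using assms(1) r unfolding fimp_def fnot_def fconj_def by blast
qed

lemma not_fimpE:
  assumes "\<not> (\<phi> \<^bold>\<longrightarrow> \<psi>) p"
  obtains q where "q \<in> P" "q \<preceq> p" "\<phi> q" "(\<^bold>\<not> \<psi>) q"
  using assms unfolding fimp_def fnot_def fconj_def by blast

lemma fiff_iff:
  assumes "regular \<phi>" "regular \<psi>"
  shows "(\<phi> \<^bold>\<longleftrightarrow> \<psi>) p \<longleftrightarrow> (\<forall>q\<in>P. q \<preceq> p \<longrightarrow> \<phi> q = \<psi> q)"
proof
  assume "(\<phi> \<^bold>\<longleftrightarrow> \<psi>) p"
  then show "\<forall>q\<in>P. q \<preceq> p \<longrightarrow> \<phi> q = \<psi> q"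
    unfolding fiff_def fconj_def using assms fimpD by blast
next
  assume "\<forall>q\<in>P. q \<preceq> p \<longrightarrow> \<phi> q = \<psi> q"
  then show "(\<phi> \<^bold>\<longleftrightarrow> \<psi>) p"
    unfolding fiff_def fconj_def by (auto intro!: fimpI)
qed

lemma fex_iff: "(\<^bold>\<exists>x. \<phi> x) p \<longleftrightarrow> (\<forall>q\<in>P. q \<preceq> p \<longrightarrow> (\<exists>r\<in>P. r \<preceq> q \<and> (\<exists>x. \<phi> x r)))"
  unfolding fex_def fnot_def fall_def by blast

lemma fexI:
  assumes "\<phi> x p" "regular (\<phi> x)" "p \<in> P"
  shows "(\<^bold>\<exists>x. \<phi> x) p"
  unfolding fex_iff using assms regular_down refl by blast

lemma fexE:
  assumes "(\<^bold>\<exists>x. \<phi> x) p" "p \<in> P"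
  obtains q x where "q \<in> P" "q \<preceq> p" "\<phi> x q"
  using assms refl unfolding fex_iff by blast

lemma fexE_below:
  assumes "(\<^bold>\<exists>x. \<phi> x) p" "q \<in> P" "q \<preceq> p"
  obtains r x where "r \<in> P" "r \<preceq> q" "\<phi> x r"
  using assms unfolding fex_iff by blast

lemma fconj_iff: "(\<phi> \<^bold>\<and> \<psi>) p \<longleftrightarrow> \<phi> p \<and> \<psi> p" by (simp add: fconj_def)

lemma fall_iff: "(\<^bold>\<forall>x. \<phi> x) p \<longleftrightarrow> (\<forall>x. \<phi> x p)" by (simp add: fall_def)

lemma ground_iff: "\<lbrakk>b\<rbrakk> p \<longleftrightarrow> b" by (simp add: ground_def)

lemma nat_mem_iff:
  "(n \<^bold>\<in> x) p \<longleftrightarrow> (\<forall>q\<in>P. q \<preceq> p \<longrightarrow> (\<exists>r\<in>P. r \<preceq> q \<and> (\<exists>s\<in>P. (n, s) \<in> x \<and> r \<preceq> s)))"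
  unfolding nat_mem_def mem_def nat_eq_def ground_def by fast

lemma real_eq_iff: "(x \<^bold>= y) p \<longleftrightarrow> (\<forall>n. \<forall>q\<in>P. q \<preceq> p \<longrightarrow> (n \<^bold>\<in> x) q = (n \<^bold>\<in> y) q)"
  by (simp add: real_eq_def fall_iff fiff_iff)

lemma real_eq_refl: "(x \<^bold>= x) p" by (simp add: real_eq_iff)

lemma real_eq_sym: "(x \<^bold>= y) p \<Longrightarrow> (y \<^bold>= x) p" by (simp add: real_eq_iff)

lemma real_eq_trans: "(x \<^bold>= y) p \<Longrightarrow> (y \<^bold>= z) p \<Longrightarrow> (x \<^bold>= z) p" by (simp add: real_eq_iff)

lemma real_mem_iff:
  "(x \<^bold>\<in>\<^bold>\<in> X) p \<longleftrightarrow>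
    (\<forall>q\<in>P. q \<preceq> p \<longrightarrow> (\<exists>r\<in>P. r \<preceq> q \<and> (\<exists>y. \<exists>s\<in>P. (y, s) \<in> X \<and> r \<preceq> s \<and> (x \<^bold>= y) r)))"
  unfolding real_mem_def mem_def by fast

lemma check_real_iff: "p \<in> P \<Longrightarrow> (n \<^bold>\<in> check_real a) p \<longleftrightarrow> n \<in> a"
  unfolding nat_mem_iff check_real_def using refl by blast

lemma nat_mem_down: "(n \<^bold>\<in> x) p \<Longrightarrow> q \<preceq> p \<Longrightarrow> (n \<^bold>\<in> x) q"
  unfolding nat_mem_iff using trans by blast

lemma real_eq_down: "(x \<^bold>= y) p \<Longrightarrow> q \<preceq> p \<Longrightarrow> (x \<^bold>= y) q"
  unfolding real_eq_iff using trans by blast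

lemma real_mem_down: "(x \<^bold>\<in>\<^bold>\<in> X) p \<Longrightarrow> q \<preceq> p \<Longrightarrow> (x \<^bold>\<in>\<^bold>\<in> X) q"
  unfolding real_mem_iff using trans by blast

text \<open>\<open>T \<times> P\<close> names the family whose members are named by the elements of
  \<open>T\<close>. This covers check families as well as finite families of arbitrary
  names.\<close>

lemma ground_family_iff:
  "(x \<^bold>\<in>\<^bold>\<in> T \<times> P) p \<longleftrightarrow> (\<forall>q\<in>P. q \<preceq> p \<longrightarrow> (\<exists>r\<in>P. r \<preceq> q \<and> (\<exists>y\<in>T. (x \<^bold>= y) r)))"
  unfolding real_mem_iff using refl by blast

lemma ground_familyI: "y \<in> T \<Longrightarrow> p \<in> P \<Longrightarrow> (y \<^bold>\<in>\<^bold>\<in> T \<times> P) p"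
  unfolding ground_family_iff using refl real_eq_refl by blast

lemma check_familyE:
  assumes "(x \<^bold>\<in>\<^bold>\<in> check_family A) p" "q \<in> P" "q \<preceq> p"
  obtains r a where "r \<in> P" "r \<preceq> q" "a \<in> A" "(x \<^bold>= check_real a) r"
  using assms unfolding check_family_def ground_family_iff by blast

lemma check_familyI: "a \<in> A \<Longrightarrow> p \<in> P \<Longrightarrow> (check_real a \<^bold>\<in>\<^bold>\<in> check_family A) p"
  unfolding check_family_def by (rule ground_familyI) auto

text \<open>The best upper bound in the ground model, known to \<open>p\<close>, of the set described by \<open>\<phi>\<close>.\<close>
definition poss :: "(nat \<Rightarrow> 'p prp) \<Rightarrow> 'p \<Rightarrow> nat set" where
  "poss \<phi> p = {n. \<exists>q\<in>P. q \<preceq> p \<and> \<phi> n q}"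

lemma poss_mono: "q \<preceq> p \<Longrightarrow> poss \<phi> q \<subseteq> poss \<phi> p"
  unfolding poss_def using trans by blast

text \<open>If \<open>poss \<phi> r\<close> is finite, then by \<open>finite_dense\<close> a
  stronger condition decides all of its members, and those decided positively form the enumerating
  list. Conversely, the list bounds \<open>poss\<close>.\<close>

lemma fin_nats_iff:
  assumes reg: "\<And>n. regular (\<phi> n)"
  shows "fin_nats \<phi> p \<longleftrightarrow> (\<forall>q\<in>P. q \<preceq> p \<longrightarrow> (\<exists>r\<in>P. r \<preceq> q \<and> finite (poss \<phi> r)))"
proof -
  have *: "(\<^bold>\<exists>y. \<lbrakk>y \<in> set ys\<rbrakk> \<^bold>\<and> nat_eq n y) q \<longleftrightarrow> n \<in> set ys" if "q \<in> P" for q n ys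
    using that refl unfolding fex_iff fconj_iff ground_iff nat_eq_def by blast
  have iff: "(\<phi> n \<^bold>\<longleftrightarrow> (\<^bold>\<exists>y. \<lbrakk>y \<in> set ys\<rbrakk> \<^bold>\<and> nat_eq n y)) r \<longleftrightarrow>
      (\<forall>q\<in>P. q \<preceq> r \<longrightarrow> \<phi> n q = (n \<in> set ys))" for n r ys
    by (subst fiff_iff) (use * reg in auto)
  have **: "fin_nats \<phi> p \<longleftrightarrow> (\<forall>q\<in>P. q \<preceq> p \<longrightarrow> (\<exists>r\<in>P. r \<preceq> q \<and>
      (\<exists>ys. \<forall>n. \<forall>s\<in>P. s \<preceq> r \<longrightarrow> \<phi> n s = (n \<in> set ys))))"
    unfolding fin_nats_def fin_def fex_iff[where \<phi> = "\<lambda>ys :: nat list. \<^bold>\<forall>x. \<phi> x \<^bold>\<longleftrightarrow> _ x ys"] fall_iff iff ..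
  have fwd: "finite (poss \<phi> r)" if "\<forall>n. \<forall>s\<in>P. s \<preceq> r \<longrightarrow> \<phi> n s = (n \<in> set ys)" for r ys
    by (rule finite_subset[of _ "set ys"]) (use that in \<open>auto simp: poss_def\<close>)
  have bwd: "\<exists>s\<in>P. s \<preceq> r \<and> (\<exists>ys. \<forall>n. \<forall>t\<in>P. t \<preceq> s \<longrightarrow> \<phi> n t = (n \<in> set ys))"
    if r: "r \<in> P" "finite (poss \<phi> r)" for r
  proof -
    have "\<exists>s\<in>P. s \<preceq> r \<and> (\<forall>n\<in>poss \<phi> r. \<phi> n s \<or> (\<^bold>\<not> \<phi> n) s)"
    proof (rule finite_dense[OF r(2,1)])
      show "\<exists>s\<in>P. s \<preceq> q \<and> (\<phi> n s \<or> (\<^bold>\<not> \<phi> n) s)" if "q \<in> P" for n q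
        using that refl[of q] not_fnotE[of "\<phi> n" q] by blast
      show "\<phi> n s \<or> (\<^bold>\<not> \<phi> n) s" if "q \<in> P" "\<phi> n q \<or> (\<^bold>\<not> \<phi> n) q" "s \<in> P" "s \<preceq> q" for n q s
        using that regular_down[OF reg] regular_down[OF regular_fnot[OF reg]] by blast
    qed
    then obtain s where s: "s \<in> P" "s \<preceq> r" "\<And>n. n \<in> poss \<phi> r \<Longrightarrow> \<phi> n s \<or> (\<^bold>\<not> \<phi> n) s" by blast
    have "finite {n. \<phi> n s}"
      by (rule finite_subset[OF _ r(2)]) (use s in \<open>auto simp: poss_def\<close>)
    then obtain ys where ys: "set ys = {n. \<phi> n s}" using finite_list by blast
    have "\<phi> n t = (n \<in> set ys)" if t: "t \<in> P" "t \<preceq> s" for n t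
    proof
      assume "\<phi> n t"
      moreover have "n \<in> poss \<phi> r" using t s \<open>\<phi> n t\<close> trans unfolding poss_def by blast
      ultimately show "n \<in> set ys" using s(3) t fnotD[of "\<phi> n" s t] ys by blast
    next
      assume "n \<in> set ys"
      then show "\<phi> n t" using regular_down[OF reg s(1)] t ys by auto
    qed
    then show ?thesis using s by blast
  qed
  show ?thesis
  proof
    assume "fin_nats \<phi> p"
    then show "\<forall>q\<in>P. q \<preceq> p \<longrightarrow> (\<exists>r\<in>P. r \<preceq> q \<and> finite (poss \<phi> r))"
      unfolding ** using fwd by meson
  next
    assume R: "\<forall>q\<in>P. q \<preceq> p \<longrightarrow> (\<exists>r\<in>P. r \<preceq> q \<and> finite (poss \<phi> r))"
    show "fin_nats \<phi> p"
      unfolding **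
    proof (intro ballI impI)
      fix q assume "q \<in> P" "q \<preceq> p"
      then obtain r where r: "r \<in> P" "r \<preceq> q" "finite (poss \<phi> r)" using R by blast
      obtain s where "s \<in> P" "s \<preceq> r" "\<exists>ys. \<forall>n. \<forall>t\<in>P. t \<preceq> s \<longrightarrow> \<phi> n t = (n \<in> set ys)"
        using bwd[OF r(1,3)] by blast
      moreover have "s \<preceq> q" using \<open>s \<preceq> r\<close> r(2) by (rule trans)
      ultimately show "\<exists>r\<in>P. r \<preceq> q \<and> (\<exists>ys. \<forall>n. \<forall>s\<in>P. s \<preceq> r \<longrightarrow> \<phi> n s = (n \<in> set ys))"
        by blast
    qed
  qed
qed

lemma fin_natsI:
  assumes "\<And>n. regular (\<phi> n)" "finite (poss \<phi> p)"
  shows "fin_nats \<phi> p"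
  unfolding fin_nats_iff[OF assms(1)]
proof (intro ballI impI)
  fix q assume "q \<in> P" "q \<preceq> p"
  then have "finite (poss \<phi> q)" using poss_mono assms(2) finite_subset by metis
  then show "\<exists>r\<in>P. r \<preceq> q \<and> finite (poss \<phi> r)" using \<open>q \<in> P\<close> refl by blast
qed

text \<open>Since \<open>poss\<close> shrinks along stronger conditions, a single condition with
  finite \<open>poss\<close> already forces finiteness.\<close>

lemma not_fin_nats_iff:
  assumes reg: "\<And>n. regular (\<phi> n)"
  shows "(\<^bold>\<not> fin_nats \<phi>) p \<longleftrightarrow> (\<forall>q\<in>P. q \<preceq> p \<longrightarrow> infinite (poss \<phi> q))"
proof
  assume L: "(\<^bold>\<not> fin_nats \<phi>) p"
  show "\<forall>q\<in>P. q \<preceq> p \<longrightarrow> infinite (poss \<phi> q)"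
  proof (intro ballI impI notI)
    fix q assume q: "q \<in> P" "q \<preceq> p" "finite (poss \<phi> q)"
    then have "fin_nats \<phi> q"
      unfolding fin_nats_iff[OF reg] using poss_mono finite_subset refl by meson
    then show False using fnotD[OF L q(1,2)] by blast
  qed
next
  assume "\<forall>q\<in>P. q \<preceq> p \<longrightarrow> infinite (poss \<phi> q)"
  then show "(\<^bold>\<not> fin_nats \<phi>) p"
    unfolding fnot_def fin_nats_iff[OF reg] using refl trans by meson
qed

lemma fin_family_ground:
  assumes "finite T" "p \<in> P"
  shows "fin_family (T \<times> P) p"
proof -
  obtain ys where ys: "set ys = T" using assms(1) finite_list by blast
  have "(x \<^bold>\<in>\<^bold>\<in> T \<times> P \<^bold>\<longleftrightarrow> (\<^bold>\<exists>y. \<lbrakk>y \<in> set ys\<rbrakk> \<^bold>\<and> x \<^bold>= y)) p" for x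
    by (subst fiff_iff) (auto simp: ground_family_iff fex_iff fconj_iff ground_iff ys Bex_def)
  then have "(\<^bold>\<forall>x. x \<^bold>\<in>\<^bold>\<in> T \<times> P \<^bold>\<longleftrightarrow> (\<^bold>\<exists>y. \<lbrakk>y \<in> set ys\<rbrakk> \<^bold>\<and> x \<^bold>= y)) p"
    by (simp add: fall_iff)
  then show ?thesis
    unfolding fin_family_def fin_def by (rule fexI) (use assms in auto)
qed

text \<open>One condition fixes a list of names that enumerates the family; which entry a given
  member equals is settled only densely below it.\<close>

lemma fin_familyE:
  assumes "fin_family X p" "p \<in> P"
  obtains q ys where "q \<in> P" "q \<preceq> p" "\<And>y. y \<in> set ys \<Longrightarrow> (y \<^bold>\<in>\<^bold>\<in> X) q"
    "\<And>x r. (x \<^bold>\<in>\<^bold>\<in> X) r \<Longrightarrow> r \<in> P \<Longrightarrow> r \<preceq> q \<Longrightarrow> \<exists>s\<in>P. s \<preceq> r \<and> (\<exists>y\<in>set ys. (x \<^bold>= y) s)"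
proof -
  obtain q ys where q: "q \<in> P" "q \<preceq> p"
    and "(\<^bold>\<forall>x. x \<^bold>\<in>\<^bold>\<in> X \<^bold>\<longleftrightarrow> (\<^bold>\<exists>y. \<lbrakk>y \<in> set ys\<rbrakk> \<^bold>\<and> x \<^bold>= y)) q"
    using assms unfolding fin_family_def fin_def by (rule fexE)
  then have iff: "(x \<^bold>\<in>\<^bold>\<in> X) r = (\<^bold>\<exists>y. \<lbrakk>y \<in> set ys\<rbrakk> \<^bold>\<and> x \<^bold>= y) r" if "r \<in> P" "r \<preceq> q" for x r
    using that by (simp add: fall_iff fiff_iff)
  show ?thesis
  proof (rule that[OF q])
    fix y assume "y \<in> set ys"
    then have "(\<lbrakk>y \<in> set ys\<rbrakk> \<^bold>\<and> y \<^bold>= y) q" by (simp add: fconj_iff ground_iff real_eq_refl)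
    then have "(\<^bold>\<exists>z. \<lbrakk>z \<in> set ys\<rbrakk> \<^bold>\<and> y \<^bold>= z) q" by (rule fexI) (use q in auto)
    then show "(y \<^bold>\<in>\<^bold>\<in> X) q" using iff q by simp
  next
    fix x r assume "(x \<^bold>\<in>\<^bold>\<in> X) r" "r \<in> P" "r \<preceq> q"
    then have "(\<^bold>\<exists>y. \<lbrakk>y \<in> set ys\<rbrakk> \<^bold>\<and> x \<^bold>= y) r" using iff by simp
    then show "\<exists>s\<in>P. s \<preceq> r \<and> (\<exists>y\<in>set ys. (x \<^bold>= y) s)"
      using \<open>r \<in> P\<close> refl unfolding fex_iff fconj_iff ground_iff by blast
  qed
qed

subsection \<open>Traces\<close>

text \<open>A name for the intersection of x with the ground-model set S.\<close>

definition restrict_name :: "'p real_name \<Rightarrow> nat set \<Rightarrow> 'p real_name" where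
  "restrict_name x S = {(n, p). n \<in> S \<and> p \<in> P \<and> (n \<^bold>\<in> x) p}"

lemma restrict_name_iff:
  assumes "p \<in> P"
  shows "(n \<^bold>\<in> restrict_name x S) p \<longleftrightarrow> n \<in> S \<and> (n \<^bold>\<in> x) p"
proof
  assume L: "(n \<^bold>\<in> restrict_name x S) p"
  have dense: "\<exists>r\<in>P. r \<preceq> q \<and> n \<in> S \<and> (n \<^bold>\<in> x) r" if q: "q \<in> P" "q \<preceq> p" for q
  proof -
    obtain r s where "r \<in> P" "r \<preceq> q" "s \<in> P" "r \<preceq> s" "n \<in> S" "(n \<^bold>\<in> x) s"
      using L[unfolded nat_mem_iff[of n "restrict_name x S"]] q unfolding restrict_name_def by blast
    then show ?thesis using nat_mem_down by blast
  qed
  then have "(n \<^bold>\<in> x) p" by (intro regular_dense[of "n \<^bold>\<in> x" p]) (use assms in auto)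
  then show "n \<in> S \<and> (n \<^bold>\<in> x) p" using dense[of p] assms by auto
next
  assume R: "n \<in> S \<and> (n \<^bold>\<in> x) p"
  then have "(n, p) \<in> restrict_name x S" using assms by (simp add: restrict_name_def)
  then show "(n \<^bold>\<in> restrict_name x S) p"
    unfolding nat_mem_iff[of n "restrict_name x S"] using assms refl by blast
qed

text \<open>Once p identifies a with a ground-model set, touching \<open>C n\<close> no longer
  depends on the extension; hence a plain equivalence instead of a density statement.\<close>

lemma touch_iff:
  assumes "(a \<^bold>= check_real b) p" "p \<in> P"
  shows "(\<^bold>\<exists>k. k \<^bold>\<in> a \<^bold>\<and> k \<^bold>\<in> check_seq C n) p \<longleftrightarrow> n \<in> touch C b"
proof -
  have "(k \<^bold>\<in> a) q \<longleftrightarrow> k \<in> b" if "q \<in> P" "q \<preceq> p" for k q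
    using assms(1) that check_real_iff[of q k b] by (auto simp: real_eq_iff)
  moreover have "(k \<^bold>\<in> check_seq C n) q \<longleftrightarrow> k \<in> C n" if "q \<in> P" for k q
    using that by (simp add: check_seq_def check_real_iff)
  ultimately have *: "(k \<^bold>\<in> a \<^bold>\<and> k \<^bold>\<in> check_seq C n) q \<longleftrightarrow> k \<in> b \<inter> C n" if "q \<in> P" "q \<preceq> p" for k q
    using that by (simp add: fconj_iff)
  show ?thesis
  proof
    assume "(\<^bold>\<exists>k. k \<^bold>\<in> a \<^bold>\<and> k \<^bold>\<in> check_seq C n) p"
    then show "n \<in> touch C b"
      by (rule fexE[OF _ assms(2)]) (use * in \<open>auto simp: touch_def\<close>)
  next
    assume "n \<in> touch C b"
    then obtain k where "k \<in> b \<inter> C n" by (auto simp: touch_def)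
    then have "(k \<^bold>\<in> a \<^bold>\<and> k \<^bold>\<in> check_seq C n) p" using * assms by simp
    then show "(\<^bold>\<exists>k. k \<^bold>\<in> a \<^bold>\<and> k \<^bold>\<in> check_seq C n) p"
      by (rule fexI) (use assms in auto)
  qed
qed

text \<open>The unfolded form of "p forces that x is infinite and equal to I \<inter> S".\<close>

definition is_trace :: "'p real_name \<Rightarrow> nat set \<Rightarrow> 'p real_name \<Rightarrow> 'p \<Rightarrow> bool" where
  "is_trace I S x p \<longleftrightarrow> (\<forall>q\<in>P. q \<preceq> p \<longrightarrow>
     (\<forall>n. (n \<^bold>\<in> x) q \<longleftrightarrow> (n \<^bold>\<in> I) q \<and> n \<in> S) \<and> infinite (poss (\<lambda>n. n \<^bold>\<in> x) q))"

lemma is_trace_down: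
  assumes "is_trace I S x p" "q \<preceq> p"
  shows "is_trace I S x q"
  unfolding is_trace_def
proof (intro ballI impI)
  fix r assume "r \<in> P" "r \<preceq> q"
  then show "(\<forall>n. (n \<^bold>\<in> x) r \<longleftrightarrow> (n \<^bold>\<in> I) r \<and> n \<in> S) \<and> infinite (poss (\<lambda>n. n \<^bold>\<in> x) r)"
    using assms(1) trans[OF _ assms(2)] unfolding is_trace_def by simp
qed

text \<open>A stronger condition picks a witness of the existential quantifier and identifies it
  with the check name of some member of \<open>A\<close>.\<close>

lemma traces_extD:
  assumes "traces_ext I (check_seq C) (check_family A) x p" "p \<in> P"
  shows "\<exists>q\<in>P. q \<preceq> p \<and> (\<exists>a\<in>A. is_trace I (touch C a) x q)"
proof -
  have ex: "(\<^bold>\<exists>a. a \<^bold>\<in>\<^bold>\<in> check_family A \<^bold>\<and>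
      (\<^bold>\<forall>n. n \<^bold>\<in> x \<^bold>\<longleftrightarrow> n \<^bold>\<in> I \<^bold>\<and> (\<^bold>\<exists>k. k \<^bold>\<in> a \<^bold>\<and> k \<^bold>\<in> check_seq C n))) p"
    and nfin: "(\<^bold>\<not> ((\<^bold>\<forall>n. n \<^bold>\<in> x \<^bold>\<longrightarrow> n \<^bold>\<in> I) \<^bold>\<and> fin_nats (\<lambda>n. n \<^bold>\<in> x))) p"
    using assms(1) unfolding traces_ext_def fconj_iff by auto
  obtain q a where q: "q \<in> P" "q \<preceq> p" and "(a \<^bold>\<in>\<^bold>\<in> check_family A \<^bold>\<and>
      (\<^bold>\<forall>n. n \<^bold>\<in> x \<^bold>\<longleftrightarrow> n \<^bold>\<in> I \<^bold>\<and> (\<^bold>\<exists>k. k \<^bold>\<in> a \<^bold>\<and> k \<^bold>\<in> check_seq C n))) q"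
    by (rule fexE[OF ex assms(2)])
  then have a: "(a \<^bold>\<in>\<^bold>\<in> check_family A) q"
    and tr: "\<And>n. (n \<^bold>\<in> x \<^bold>\<longleftrightarrow> n \<^bold>\<in> I \<^bold>\<and> (\<^bold>\<exists>k. k \<^bold>\<in> a \<^bold>\<and> k \<^bold>\<in> check_seq C n)) q"
    by (simp_all only: fconj_iff fall_iff)
  obtain r b where r: "r \<in> P" "r \<preceq> q" and b: "b \<in> A" "(a \<^bold>= check_real b) r"
    using check_familyE[OF a q(1) refl] .
  have eq: "(n \<^bold>\<in> x) s \<longleftrightarrow> (n \<^bold>\<in> I) s \<and> n \<in> touch C b" if s: "s \<in> P" "s \<preceq> r" for n s
  proof -
    have "(a \<^bold>= check_real b) s" using real_eq_down[OF b(2) s(2)] .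
    moreover have "s \<preceq> q" using s r trans by blast
    ultimately show ?thesis
      using tr[of n] s touch_iff by (simp add: fiff_iff fconj_iff)
  qed
  have "infinite (poss (\<lambda>n. n \<^bold>\<in> x) s)" if s: "s \<in> P" "s \<preceq> r" for s
  proof
    assume "finite (poss (\<lambda>n. n \<^bold>\<in> x) s)"
    then have "fin_nats (\<lambda>n. n \<^bold>\<in> x) s"
      by (intro fin_natsI) auto
    \<comment> \<open>x is forced to be a subset of I, so the exclusion of finite subsets of I
      amounts to x being infinite.\<close>
    moreover have "(\<^bold>\<forall>n. n \<^bold>\<in> x \<^bold>\<longrightarrow> n \<^bold>\<in> I) s"
      unfolding fall_iff
    proof (intro allI fimpI)
      show "(n \<^bold>\<in> I) t" if "t \<in> P" "t \<preceq> s" "(n \<^bold>\<in> x) t" for n t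
        using eq[OF that(1) trans[OF that(2) s(2)]] that(3) by blast
    qed
    moreover have "s \<preceq> p" using s r q trans by blast
    ultimately show False using fnotD[OF nfin s(1)] by (simp add: fconj_iff)
  qed
  then have "is_trace I (touch C b) x r" unfolding is_trace_def using eq by blast
  then show ?thesis using r q b trans by blast
qed

lemma traces_extI:
  assumes "is_trace I (touch C a) x p" "p \<in> P" "a \<in> A"
  shows "traces_ext I (check_seq C) (check_family A) x p"
proof -
  have "(n \<^bold>\<in> x \<^bold>\<longleftrightarrow> n \<^bold>\<in> I \<^bold>\<and> (\<^bold>\<exists>k. k \<^bold>\<in> check_real a \<^bold>\<and> k \<^bold>\<in> check_seq C n)) p" for n
    by (subst fiff_iff)
      (use assms(1) touch_iff[OF real_eq_refl] in \<open>auto simp: fconj_iff is_trace_def\<close>)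
  then have "(check_real a \<^bold>\<in>\<^bold>\<in> check_family A \<^bold>\<and>
      (\<^bold>\<forall>n. n \<^bold>\<in> x \<^bold>\<longleftrightarrow> n \<^bold>\<in> I \<^bold>\<and> (\<^bold>\<exists>k. k \<^bold>\<in> check_real a \<^bold>\<and> k \<^bold>\<in> check_seq C n))) p"
    by (simp add: fconj_iff fall_iff check_familyI assms)
  then have "(\<^bold>\<exists>a. a \<^bold>\<in>\<^bold>\<in> check_family A \<^bold>\<and>
      (\<^bold>\<forall>n. n \<^bold>\<in> x \<^bold>\<longleftrightarrow> n \<^bold>\<in> I \<^bold>\<and> (\<^bold>\<exists>k. k \<^bold>\<in> a \<^bold>\<and> k \<^bold>\<in> check_seq C n))) p"
    by (rule fexI) (use assms in auto)
  moreover have "\<not> fin_nats (\<lambda>n. n \<^bold>\<in> x) q" if "q \<in> P" "q \<preceq> p" for q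
  proof -
    have "(\<^bold>\<not> fin_nats (\<lambda>n. n \<^bold>\<in> x)) p"
      by (subst not_fin_nats_iff) (use assms(1) in \<open>auto simp: is_trace_def\<close>)
    then show ?thesis using that by (rule fnotD)
  qed
  then have "(\<^bold>\<not> ((\<^bold>\<forall>n. n \<^bold>\<in> x \<^bold>\<longrightarrow> n \<^bold>\<in> I) \<^bold>\<and> fin_nats (\<lambda>n. n \<^bold>\<in> x))) p"
    by (auto intro!: fnotI simp: fconj_iff)
  ultimately show ?thesis unfolding traces_ext_def fconj_iff by simp
qed

definition downward :: "(nat \<Rightarrow> 'p prp) \<Rightarrow> bool" where
  "downward \<rho> \<longleftrightarrow> (\<forall>n. \<forall>p\<in>P. \<forall>q\<in>P. \<rho> n p \<longrightarrow> q \<preceq> p \<longrightarrow> \<rho> n q)"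

text \<open>The combinatorial content of ``\<open>C\<close> witnesses that \<open>A\<close> is not fin-intersecting in the
  extension'': names \<open>I\<close> enter only through the relations \<open>\<rho> n p\<close>, read as ``\<open>p\<close> forces \<open>n \<in> I\<close>''.\<close>
definition comb_witness :: "(nat \<Rightarrow> nat set) \<Rightarrow> nat set set \<Rightarrow> bool" where
  "comb_witness C A \<longleftrightarrow> (\<forall>\<rho>. downward \<rho> \<longrightarrow> (\<forall>p\<in>P. (\<forall>q\<in>P. q \<preceq> p \<longrightarrow> infinite (poss \<rho> q)) \<longrightarrow>
     (\<exists>q\<in>P. q \<preceq> p \<and> (\<exists>F. finite F \<and> F \<noteq> {} \<and> F \<subseteq> A \<and>
        (\<forall>a\<in>F. \<forall>r\<in>P. r \<preceq> q \<longrightarrow> infinite (poss \<rho> r \<inter> touch C a)) \<and>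
        finite (poss \<rho> q \<inter> (\<Inter>a\<in>F. touch C a))))))"

text \<open>This extracts the combinatorial property from forced statements, as required for a pair
  of which only such statements are known. A relation \<rho> is turned into a name, and a finite
  family of traces with finite intersection into a finite subset of \<open>A\<close>.\<close>

lemma comb_witnessI:
  assumes w: "\<And>p. p \<in> P \<Longrightarrow> witnesses_non_fi_ext (check_seq C) (check_family A) p"
  shows "comb_witness C A"
  unfolding comb_witness_def
proof (intro allI impI ballI)
  fix \<rho> p assume down: "downward \<rho>" and p: "p \<in> P" and inf: "\<forall>q\<in>P. q \<preceq> p \<longrightarrow> infinite (poss \<rho> q)"
  define I where "I = {(n, s). \<rho> n s}"
  have \<rho>I: "(n \<^bold>\<in> I) q" if "\<rho> n q" "q \<in> P" for n q
    using that refl unfolding nat_mem_iff I_def by blast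
  \<comment> \<open>Downward closure of \<rho> ensures that passing to the name makes no further
    numbers possible.\<close>
  have possI: "poss (\<lambda>n. n \<^bold>\<in> I) q = poss \<rho> q" for q
  proof (intro equalityI subsetI)
    fix n assume "n \<in> poss (\<lambda>n. n \<^bold>\<in> I) q"
    then obtain r where r: "r \<in> P" "r \<preceq> q" "(n \<^bold>\<in> I) r" by (auto simp: poss_def)
    then obtain s t where "s \<in> P" "s \<preceq> r" "t \<in> P" "\<rho> n t" "s \<preceq> t"
      unfolding nat_mem_iff I_def using refl[of r] by blast
    then show "n \<in> poss \<rho> q"
      using r down trans unfolding poss_def downward_def by blast
  qed (use \<rho>I in \<open>auto simp: poss_def\<close>)
  have "(\<^bold>\<not> fin_nats (\<lambda>n. n \<^bold>\<in> I)) p"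
    by (subst not_fin_nats_iff) (use inf possI in auto)
  moreover have imp: "((\<^bold>\<not> fin_nats (\<lambda>n. n \<^bold>\<in> I)) \<^bold>\<longrightarrow>
      (\<^bold>\<not> centered_ext (traces_ext I (check_seq C) (check_family A)))) p"
    using w[OF p] unfolding witnesses_non_fi_ext_def fconj_iff fall_iff by blast
  ultimately have "(\<^bold>\<not> centered_ext (traces_ext I (check_seq C) (check_family A))) p"
    by (intro fimpD[OF imp, OF p refl]) auto
  then have "\<not> centered_ext (traces_ext I (check_seq C) (check_family A)) p"
    using p refl by (rule fnotD)
  then obtain B where "\<not> (fin_family B \<^bold>\<and> (\<^bold>\<exists>b. b \<^bold>\<in>\<^bold>\<in> B) \<^bold>\<and>
      (\<^bold>\<forall>b. b \<^bold>\<in>\<^bold>\<in> B \<^bold>\<longrightarrow> traces_ext I (check_seq C) (check_family A) b) \<^bold>\<longrightarrow>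
      (\<^bold>\<not> fin_nats (\<lambda>n. \<^bold>\<forall>b. b \<^bold>\<in>\<^bold>\<in> B \<^bold>\<longrightarrow> n \<^bold>\<in> b))) p"
    unfolding centered_ext_def fall_iff[of _ p] by blast
  then obtain q where q: "q \<in> P" "q \<preceq> p" and hyp: "(fin_family B \<^bold>\<and> (\<^bold>\<exists>b. b \<^bold>\<in>\<^bold>\<in> B) \<^bold>\<and>
      (\<^bold>\<forall>b. b \<^bold>\<in>\<^bold>\<in> B \<^bold>\<longrightarrow> traces_ext I (check_seq C) (check_family A) b)) q"
    and finI: "(\<^bold>\<not> (\<^bold>\<not> fin_nats (\<lambda>n. \<^bold>\<forall>b. b \<^bold>\<in>\<^bold>\<in> B \<^bold>\<longrightarrow> n \<^bold>\<in> b))) q"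
    by (rule not_fimpE)
  then have finB: "fin_family B q" and neB: "(\<^bold>\<exists>b. b \<^bold>\<in>\<^bold>\<in> B) q"
    and trB: "\<And>b. (b \<^bold>\<in>\<^bold>\<in> B \<^bold>\<longrightarrow> traces_ext I (check_seq C) (check_family A) b) q"
    by (simp_all only: fconj_iff fall_iff)
  have "\<not> (\<^bold>\<not> fin_nats (\<lambda>n. \<^bold>\<forall>b. b \<^bold>\<in>\<^bold>\<in> B \<^bold>\<longrightarrow> n \<^bold>\<in> b)) q"
    using finI q(1) refl by (rule fnotD)
  then obtain r where r: "r \<in> P" "r \<preceq> q" "finite (poss (\<lambda>n. \<^bold>\<forall>b. b \<^bold>\<in>\<^bold>\<in> B \<^bold>\<longrightarrow> n \<^bold>\<in> b) r)"
    by (subst (asm) not_fin_nats_iff) auto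
  have fam: "fin_family B r" using regular_down[of "fin_family B" q r] q r finB by simp
  obtain s ys where s: "s \<in> P" "s \<preceq> r" and ys: "\<And>y. y \<in> set ys \<Longrightarrow> (y \<^bold>\<in>\<^bold>\<in> B) s"
    and mem: "\<And>x t. (x \<^bold>\<in>\<^bold>\<in> B) t \<Longrightarrow> t \<in> P \<Longrightarrow> t \<preceq> s \<Longrightarrow> \<exists>u\<in>P. u \<preceq> t \<and> (\<exists>y\<in>set ys. (x \<^bold>= y) u)"
    using fin_familyE[OF fam r(1)] by metis
  have sq: "s \<preceq> q" using s r trans by blast
  have "ys \<noteq> []"
  proof
    assume "ys = []"
    obtain t b where "t \<in> P" "t \<preceq> s" "(b \<^bold>\<in>\<^bold>\<in> B) t" using fexE_below[OF neB s(1) sq] .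
    then show False using mem \<open>ys = []\<close> by fastforce
  qed
  \<comment> \<open>One condition settles, for all of the finitely many names in \<open>ys\<close>
    at once, of which member of \<open>A\<close> each is the trace.\<close>
  have "\<exists>t\<in>P. t \<preceq> s \<and> (\<forall>y\<in>set ys. \<exists>a\<in>A. is_trace I (touch C a) y t)"
  proof (rule finite_dense[OF _ s(1)])
    fix y t assume t: "y \<in> set ys" "t \<in> P" "t \<preceq> s"
    have "(y \<^bold>\<in>\<^bold>\<in> B) t" using real_mem_down[OF ys[OF t(1)] t(3)] .
    then have "traces_ext I (check_seq C) (check_family A) y t"
      using fimpD[OF trB, OF t(2) trans[OF t(3) sq]] by simp
    then show "\<exists>u\<in>P. u \<preceq> t \<and> (\<exists>a\<in>A. is_trace I (touch C a) y u)"
      using t(2) by (rule traces_extD)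
  qed (auto intro: is_trace_down)
  then obtain t f where t: "t \<in> P" "t \<preceq> s"
    and f: "\<And>y. y \<in> set ys \<Longrightarrow> f y \<in> A \<and> is_trace I (touch C (f y)) y t"
    by metis
  \<comment> \<open>If u below t forces n into I and n is touched by all \<open>f y\<close>, then u
    forces n into every member of \<open>B\<close>, because each member equals an entry of
    \<open>ys\<close> densely below u.\<close>
  have "poss \<rho> t \<inter> (\<Inter>a\<in>f ` set ys. touch C a) \<subseteq> poss (\<lambda>n. \<^bold>\<forall>b. b \<^bold>\<in>\<^bold>\<in> B \<^bold>\<longrightarrow> n \<^bold>\<in> b) r"
  proof
    fix n assume "n \<in> poss \<rho> t \<inter> (\<Inter>a\<in>f ` set ys. touch C a)"
    then obtain u where u: "u \<in> P" "u \<preceq> t" "(n \<^bold>\<in> I) u" and touch: "\<And>y. y \<in> set ys \<Longrightarrow> n \<in> touch C (f y)"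
      unfolding possI[symmetric] by (auto simp: poss_def)
    have "(n \<^bold>\<in> b) v" if v: "v \<in> P" "v \<preceq> u" "(b \<^bold>\<in>\<^bold>\<in> B) v" for b v
    proof (rule regular_dense[OF _ v(1)])
      fix w assume w: "w \<in> P" "w \<preceq> v"
      then have "(b \<^bold>\<in>\<^bold>\<in> B) w" using real_mem_down[OF v(3)] by simp
      moreover have "w \<preceq> s" using w v u t trans by meson
      ultimately obtain z y where z: "z \<in> P" "z \<preceq> w" "y \<in> set ys" "(b \<^bold>= y) z"
        using mem w(1) by blast
      have "z \<preceq> u" "z \<preceq> t" using z w v u trans by meson+
      then have "(n \<^bold>\<in> I) z" using nat_mem_down[OF u(3)] by simp
      then have "(n \<^bold>\<in> y) z" using f[OF z(3)] touch[OF z(3)] z \<open>z \<preceq> t\<close> by (simp add: is_trace_def)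
      then have "(n \<^bold>\<in> b) z" using z(1,4) by (simp add: real_eq_iff)
      then show "\<exists>r\<in>P. r \<preceq> w \<and> (n \<^bold>\<in> b) r" using z by blast
    qed simp
    then have "(\<^bold>\<forall>b. b \<^bold>\<in>\<^bold>\<in> B \<^bold>\<longrightarrow> n \<^bold>\<in> b) u" unfolding fall_iff by (blast intro: fimpI)
    moreover have "u \<preceq> r" using u t s trans by meson
    ultimately show "n \<in> poss (\<lambda>n. \<^bold>\<forall>b. b \<^bold>\<in>\<^bold>\<in> B \<^bold>\<longrightarrow> n \<^bold>\<in> b) r" using u(1) unfolding poss_def by blast
  qed
  then have "finite (poss \<rho> t \<inter> (\<Inter>a\<in>f ` set ys. touch C a))" using r(3) by (rule finite_subset)
  moreover have "infinite (poss \<rho> u \<inter> touch C (f y))" if u: "u \<in> P" "u \<preceq> t" and y: "y \<in> set ys" for u y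
  proof -
    have "infinite (poss (\<lambda>n. n \<^bold>\<in> y) u)" using f[OF y] u by (simp add: is_trace_def)
    moreover have "poss (\<lambda>n. n \<^bold>\<in> y) u \<subseteq> poss (\<lambda>n. n \<^bold>\<in> I) u \<inter> touch C (f y)"
      using f[OF y] u trans unfolding poss_def is_trace_def by blast
    ultimately show ?thesis using possI finite_subset by metis
  qed
  moreover have "t \<preceq> p" using t sq q trans by meson
  ultimately show "\<exists>q\<in>P. q \<preceq> p \<and> (\<exists>F. finite F \<and> F \<noteq> {} \<and> F \<subseteq> A \<and>
        (\<forall>a\<in>F. \<forall>r\<in>P. r \<preceq> q \<longrightarrow> infinite (poss \<rho> r \<inter> touch C a)) \<and>
        finite (poss \<rho> q \<inter> (\<Inter>a\<in>F. touch C a)))"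
    using t(1) f \<open>ys \<noteq> []\<close> by (intro bexI[of _ t] conjI exI[of _ "f ` set ys"]) auto
qed

lemma fin_seq_ext_check:
  assumes C: "fin_seq C" and p: "p \<in> P"
  shows "fin_seq_ext (check_seq C) p"
proof -
  have mem: "(k \<^bold>\<in> check_seq C n) q \<longleftrightarrow> k \<in> C n" if "q \<in> P" for k n q
    using that by (simp add: check_seq_def check_real_iff)
  have "fin_nats (\<lambda>k. k \<^bold>\<in> check_seq C n) p" for n
  proof -
    have "finite (poss (\<lambda>k. k \<^bold>\<in> check_seq C n) q)" for q
      by (rule finite_subset[of _ "C n"]) (use mem C in \<open>auto simp: poss_def fin_seq_def\<close>)
    then show ?thesis by (intro fin_natsI) auto
  qed
  moreover have "(\<^bold>\<exists>k. k \<^bold>\<in> check_seq C n) p" for n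
  proof -
    obtain k where "k \<in> C n" using C unfolding fin_seq_def by blast
    then show ?thesis by (intro fexI[where x = k]) (use mem p in auto)
  qed
  moreover have "((\<^bold>\<not> nat_eq n m) \<^bold>\<longrightarrow> (\<^bold>\<not> (\<^bold>\<exists>k. k \<^bold>\<in> check_seq C n \<^bold>\<and> k \<^bold>\<in> check_seq C m))) p" for n m
  proof (rule fimpI, rule fnotI)
    fix q r assume "q \<in> P" "q \<preceq> p" "(\<^bold>\<not> nat_eq n m) q" "r \<in> P" "r \<preceq> q"
      and ex: "(\<^bold>\<exists>k. k \<^bold>\<in> check_seq C n \<^bold>\<and> k \<^bold>\<in> check_seq C m) r"
    then have "n \<noteq> m" using fnotD[of "nat_eq n m" q q] by (simp add: nat_eq_def ground_iff)
    then have "C n \<inter> C m = {}" using C by (simp add: fin_seq_def)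
    then have "\<not> (k \<^bold>\<in> check_seq C n \<^bold>\<and> k \<^bold>\<in> check_seq C m) s" if "s \<in> P" for k s
      using mem[OF that] by (auto simp: fconj_iff)
    then show False using fexE[OF ex \<open>r \<in> P\<close>] by blast
  qed
  ultimately show ?thesis unfolding fin_seq_ext_def by (simp add: fconj_iff fall_iff)
qed

text \<open>The traces of the sets in \<open>F\<close> on a name I form a finite family. A number in
  all of them lies in I and is touched by every set in \<open>F\<close>, so the intersection is
  forced to be finite and centeredness fails.\<close>

lemma witnesses_non_fi_extI:
  assumes cw: "comb_witness C A" and C: "fin_seq C" and p: "p \<in> P"
  shows "witnesses_non_fi_ext (check_seq C) (check_family A) p"
proof -
  have "(\<^bold>\<not> centered_ext (traces_ext I (check_seq C) (check_family A))) q"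
    if q: "q \<in> P" "(\<^bold>\<not> fin_nats (\<lambda>n. n \<^bold>\<in> I)) q" for I q
  proof (rule fnotI)
    fix r assume r: "r \<in> P" "r \<preceq> q"
      and cent: "centered_ext (traces_ext I (check_seq C) (check_family A)) r"
    have inf: "infinite (poss (\<lambda>n. n \<^bold>\<in> I) s)" if "s \<in> P" "s \<preceq> q" for s
      using q(2) that by (subst (asm) not_fin_nats_iff) auto
    have "downward (\<lambda>n. n \<^bold>\<in> I)" unfolding downward_def by (auto intro: regular_down)
    then obtain s F where s: "s \<in> P" "s \<preceq> r" and F: "finite F" "F \<noteq> {}" "F \<subseteq> A"
      and infF: "\<And>a t. a \<in> F \<Longrightarrow> t \<in> P \<Longrightarrow> t \<preceq> s \<Longrightarrow> infinite (poss (\<lambda>n. n \<^bold>\<in> I) t \<inter> touch C a)"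
      and finF: "finite (poss (\<lambda>n. n \<^bold>\<in> I) s \<inter> (\<Inter>a\<in>F. touch C a))"
      using cw[unfolded comb_witness_def, rule_format, of "\<lambda>n. n \<^bold>\<in> I" r] inf r trans by metis
    \<comment> \<open>Explicit names for the traces of the sets in \<open>F\<close>; the
      counterexample to centeredness is \<open>T \<times> P\<close>.\<close>
    define T where "T = (\<lambda>a. restrict_name I (touch C a)) ` F"
    have tr: "is_trace I (touch C a) (restrict_name I (touch C a)) s" if "a \<in> F" for a
    proof -
      have "poss (\<lambda>n. n \<^bold>\<in> restrict_name I (touch C a)) t = poss (\<lambda>n. n \<^bold>\<in> I) t \<inter> touch C a" for t
        unfolding poss_def by (auto simp: restrict_name_iff)
      then show ?thesis unfolding is_trace_def using infF[OF that] by (auto simp: restrict_name_iff)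
    qed
    have "fin_family (T \<times> P) s" by (rule fin_family_ground) (use F s in \<open>auto simp: T_def\<close>)
    moreover have "(\<^bold>\<exists>b. b \<^bold>\<in>\<^bold>\<in> T \<times> P) s"
    proof -
      obtain y where "y \<in> T" using F by (auto simp: T_def)
      then show ?thesis by (intro fexI[where x = y] ground_familyI) (use s in auto)
    qed
    moreover have "(\<^bold>\<forall>b. b \<^bold>\<in>\<^bold>\<in> T \<times> P \<^bold>\<longrightarrow> traces_ext I (check_seq C) (check_family A) b) s"
      unfolding fall_iff
    proof (intro allI fimpI)
      fix b t assume t: "t \<in> P" "t \<preceq> s" "(b \<^bold>\<in>\<^bold>\<in> T \<times> P) t"
      show "traces_ext I (check_seq C) (check_family A) b t"
      proof (rule regular_dense[OF _ t(1)])
        fix u assume u: "u \<in> P" "u \<preceq> t"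
        then obtain v a where v: "v \<in> P" "v \<preceq> u" "a \<in> F" "(b \<^bold>= restrict_name I (touch C a)) v"
          using t(3) unfolding ground_family_iff T_def by blast
        then have "v \<preceq> s" using u t trans by meson
        then have "is_trace I (touch C a) (restrict_name I (touch C a)) v"
          using tr[OF v(3)] is_trace_down by blast
        moreover have "poss (\<lambda>n. n \<^bold>\<in> b) w = poss (\<lambda>n. n \<^bold>\<in> restrict_name I (touch C a)) w" if "w \<preceq> v" for w
          using v(4) that trans unfolding poss_def real_eq_iff by blast
        ultimately have "is_trace I (touch C a) b v"
          using v(4) unfolding is_trace_def real_eq_iff by simp
        then show "\<exists>r\<in>P. r \<preceq> u \<and> traces_ext I (check_seq C) (check_family A) b r"
          using v F(3) traces_extI by blast
      qed simp
    qed
    moreover have "(fin_family (T \<times> P) \<^bold>\<and> (\<^bold>\<exists>b. b \<^bold>\<in>\<^bold>\<in> T \<times> P) \<^bold>\<and>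
        (\<^bold>\<forall>b. b \<^bold>\<in>\<^bold>\<in> T \<times> P \<^bold>\<longrightarrow> traces_ext I (check_seq C) (check_family A) b) \<^bold>\<longrightarrow>
        (\<^bold>\<not> fin_nats (\<lambda>n. \<^bold>\<forall>b. b \<^bold>\<in>\<^bold>\<in> T \<times> P \<^bold>\<longrightarrow> n \<^bold>\<in> b))) r"
      using cent unfolding centered_ext_def fall_iff by blast
    note fimpD[OF this, OF s]
    ultimately have "(\<^bold>\<not> fin_nats (\<lambda>n. \<^bold>\<forall>b. b \<^bold>\<in>\<^bold>\<in> T \<times> P \<^bold>\<longrightarrow> n \<^bold>\<in> b)) s"
      by (auto simp: fconj_iff)
    then have "infinite (poss (\<lambda>n. \<^bold>\<forall>b. b \<^bold>\<in>\<^bold>\<in> T \<times> P \<^bold>\<longrightarrow> n \<^bold>\<in> b) s)"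
      by (subst (asm) not_fin_nats_iff) (use s in auto)
    moreover have "poss (\<lambda>n. \<^bold>\<forall>b. b \<^bold>\<in>\<^bold>\<in> T \<times> P \<^bold>\<longrightarrow> n \<^bold>\<in> b) s \<subseteq> poss (\<lambda>n. n \<^bold>\<in> I) s \<inter> (\<Inter>a\<in>F. touch C a)"
    proof
      fix n assume "n \<in> poss (\<lambda>n. \<^bold>\<forall>b. b \<^bold>\<in>\<^bold>\<in> T \<times> P \<^bold>\<longrightarrow> n \<^bold>\<in> b) s"
      then obtain u where u: "u \<in> P" "u \<preceq> s" and all: "\<And>b. (b \<^bold>\<in>\<^bold>\<in> T \<times> P \<^bold>\<longrightarrow> n \<^bold>\<in> b) u"
        by (auto simp: poss_def fall_iff)
      have "n \<in> touch C a \<and> (n \<^bold>\<in> I) u" if "a \<in> F" for a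
      proof -
        have "(restrict_name I (touch C a) \<^bold>\<in>\<^bold>\<in> T \<times> P) u"
          by (rule ground_familyI) (use that u in \<open>auto simp: T_def\<close>)
        then have "(n \<^bold>\<in> restrict_name I (touch C a)) u"
          by (intro fimpD[OF all, OF u(1) refl]) auto
        then show ?thesis using restrict_name_iff[OF u(1)] by blast
      qed
      then show "n \<in> poss (\<lambda>n. n \<^bold>\<in> I) s \<inter> (\<Inter>a\<in>F. touch C a)"
        using F(2) u unfolding poss_def by blast
    qed
    ultimately show False using finF finite_subset by blast
  qed
  then show ?thesis
    unfolding witnesses_non_fi_ext_def fconj_iff fall_iff
    using fin_seq_ext_check[OF C p] by (blast intro: fimpI)
qed

lemma not_fin_intersecting_extI:
  assumes w: "\<And>p. p \<in> P \<Longrightarrow> witnesses_non_fi_ext (check_seq C) X p" and p: "p \<in> P"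
  shows "(\<^bold>\<not> fin_intersecting_ext X) p"
proof (rule fnotI)
  fix q assume q: "q \<in> P" and fi: "fin_intersecting_ext X q"
  have C: "fin_seq_ext (check_seq C) q"
    and wI: "\<And>I. ((\<^bold>\<not> fin_nats (\<lambda>n. n \<^bold>\<in> I)) \<^bold>\<longrightarrow> (\<^bold>\<not> centered_ext (traces_ext I (check_seq C) X))) q"
    using w[OF q] unfolding witnesses_non_fi_ext_def fconj_iff fall_iff by blast+
  have "(fin_seq_ext (check_seq C) \<^bold>\<longrightarrow>
      (\<^bold>\<exists>I. (\<^bold>\<not> fin_nats (\<lambda>n. n \<^bold>\<in> I)) \<^bold>\<and> centered_ext (traces_ext I (check_seq C) X))) q"
    using fi unfolding fin_intersecting_ext_def fall_iff by blast
  from fimpD[OF this, OF q refl C]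
  have "(\<^bold>\<exists>I. (\<^bold>\<not> fin_nats (\<lambda>n. n \<^bold>\<in> I)) \<^bold>\<and> centered_ext (traces_ext I (check_seq C) X)) q"
    by simp
  then obtain r I where r: "r \<in> P" "r \<preceq> q" and I: "(\<^bold>\<not> fin_nats (\<lambda>n. n \<^bold>\<in> I)) r"
    "centered_ext (traces_ext I (check_seq C) X) r"
    by (rule fexE[OF _ q]) (auto simp: fconj_iff)
  have "(\<^bold>\<not> centered_ext (traces_ext I (check_seq C) X)) r"
    using fimpD[OF wI, OF r I(1)] by simp
  from fnotD[OF this r(1) refl] show False using I(2) by blast
qed

section \<open>Preservation of almost disjointness, of maximality and of the witness\<close>

lemma almost_disjoint_ext_check:
  assumes A: "almost_disjoint A" and p: "p \<in> P"
  shows "almost_disjoint_ext (check_family A) p"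
proof -
  have inj: "a = b" if "(check_real a \<^bold>= check_real b) q" "q \<in> P" for a b q
    using that refl check_real_iff[OF that(2)] unfolding real_eq_iff by blast
  have nf: "(\<^bold>\<not> fin_family (check_family A)) p"
  proof (rule fnotI)
    fix q assume "q \<in> P" "fin_family (check_family A) q"
    then obtain r ys where r: "r \<in> P" and mem: "\<And>x s. (x \<^bold>\<in>\<^bold>\<in> check_family A) s \<Longrightarrow> s \<in> P \<Longrightarrow> s \<preceq> r \<Longrightarrow>
        \<exists>t\<in>P. t \<preceq> s \<and> (\<exists>y\<in>set ys. (x \<^bold>= y) t)"
      using fin_familyE[of "check_family A" q] by metis
    \<comment> \<open>With more members of \<open>A\<close> than entries in the list, the pigeonhole
      principle makes some condition force two distinct members to equal the same entry.\<close>
    obtain S where S: "finite S" "card S = Suc (length ys)" "S \<subseteq> A"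
      using A infinite_arbitrarily_large unfolding almost_disjoint_def by metis
    have "\<exists>s\<in>P. s \<preceq> r \<and> (\<forall>a\<in>S. \<exists>y\<in>set ys. (check_real a \<^bold>= y) s)"
    proof (rule finite_dense[OF S(1) r])
      show "\<exists>t\<in>P. t \<preceq> s \<and> (\<exists>y\<in>set ys. (check_real a \<^bold>= y) t)" if "a \<in> S" "s \<in> P" "s \<preceq> r" for a s
        using mem[OF check_familyI] that S(3) by blast
    qed (use real_eq_down in blast)
    then obtain s f where s: "s \<in> P" and f: "\<And>a. a \<in> S \<Longrightarrow> f a \<in> set ys \<and> (check_real a \<^bold>= f a) s"
      by metis
    have "card (f ` S) \<le> card (set ys)" by (rule card_mono) (use f in auto)
    also have "\<dots> < card S" using S(2) card_length[of ys] by simp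
    finally have "\<not> inj_on f S" using card_image by fastforce
    then obtain a b where ab: "a \<in> S" "b \<in> S" "a \<noteq> b" "f a = f b" by (auto simp: inj_on_def)
    have "(check_real a \<^bold>= check_real b) s"
      using f[OF ab(1)] f[OF ab(2)] ab(4) real_eq_trans real_eq_sym by metis
    then show False using inj s ab(3) by blast
  qed
  have inf: "(\<^bold>\<not> fin_nats (\<lambda>n. n \<^bold>\<in> a)) q" if q: "q \<in> P" "(a \<^bold>\<in>\<^bold>\<in> check_family A) q" for a q
  proof -
    have "infinite (poss (\<lambda>n. n \<^bold>\<in> a) r)" if r: "r \<in> P" "r \<preceq> q" for r
    proof -
      obtain s b where s: "s \<in> P" "s \<preceq> r" "b \<in> A" "(a \<^bold>= check_real b) s"
        using check_familyE[OF q(2) r] .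
      then have "b \<subseteq> poss (\<lambda>n. n \<^bold>\<in> a) r"
        unfolding poss_def real_eq_iff using check_real_iff refl by blast
      moreover have "infinite b" using s A by (auto simp: almost_disjoint_def)
      ultimately show ?thesis using finite_subset by blast
    qed
    then show ?thesis by (subst not_fin_nats_iff) auto
  qed
  have int: "fin_nats (\<lambda>n. n \<^bold>\<in> a \<^bold>\<and> n \<^bold>\<in> b) q"
    if q: "q \<in> P" "(a \<^bold>\<in>\<^bold>\<in> check_family A) q" "(b \<^bold>\<in>\<^bold>\<in> check_family A) q" "(\<^bold>\<not> a \<^bold>= b) q" for a b q
  proof -
    have "\<exists>s\<in>P. s \<preceq> r \<and> finite (poss (\<lambda>n. n \<^bold>\<in> a \<^bold>\<and> n \<^bold>\<in> b) s)" if r: "r \<in> P" "r \<preceq> q" for r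
    proof -
      obtain s c where s: "s \<in> P" "s \<preceq> r" "c \<in> A" "(a \<^bold>= check_real c) s"
        using check_familyE[OF q(2) r] .
      have sq: "s \<preceq> q" using s r trans by blast
      obtain t d where t: "t \<in> P" "t \<preceq> s" "d \<in> A" "(b \<^bold>= check_real d) t"
        using check_familyE[OF q(3) s(1) sq] .
      have c: "(a \<^bold>= check_real c) t" using real_eq_down[OF s(4) t(2)] .
      have "t \<preceq> q" using t sq trans by blast
      then have "c \<noteq> d" using fnotD[OF q(4) t(1)] c t(4) real_eq_trans real_eq_sym by blast
      then have "finite (c \<inter> d)" using A s t unfolding almost_disjoint_def by blast
      moreover have "poss (\<lambda>n. n \<^bold>\<in> a \<^bold>\<and> n \<^bold>\<in> b) t \<subseteq> c \<inter> d"
        using c t(4) check_real_iff unfolding poss_def real_eq_iff fconj_iff by blast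
      ultimately show ?thesis using t s trans finite_subset by meson
    qed
    then show ?thesis by (subst fin_nats_iff) auto
  qed
  have "(a \<^bold>\<in>\<^bold>\<in> check_family A \<^bold>\<longrightarrow> (\<^bold>\<forall>b. b \<^bold>\<in>\<^bold>\<in> check_family A \<^bold>\<longrightarrow>
      (\<^bold>\<not> a \<^bold>= b) \<^bold>\<longrightarrow> fin_nats (\<lambda>n. n \<^bold>\<in> a \<^bold>\<and> n \<^bold>\<in> b))) p" for a
  proof (intro fimpI fall_iff[THEN iffD2] allI)
    fix b q r s
    assume qr: "(a \<^bold>\<in>\<^bold>\<in> check_family A) q" "r \<preceq> q" "(b \<^bold>\<in>\<^bold>\<in> check_family A) r"
      and s: "s \<in> P" "s \<preceq> r" "(\<^bold>\<not> a \<^bold>= b) s"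
    have "(a \<^bold>\<in>\<^bold>\<in> check_family A) s" using qr s trans real_mem_down by meson
    moreover have "(b \<^bold>\<in>\<^bold>\<in> check_family A) s" using qr(3) s(2) by (rule real_mem_down)
    ultimately show "fin_nats (\<lambda>n. n \<^bold>\<in> a \<^bold>\<and> n \<^bold>\<in> b) s" by (rule int[OF s(1) _ _ s(3)])
  qed
  moreover have "(a \<^bold>\<in>\<^bold>\<in> check_family A \<^bold>\<longrightarrow> (\<^bold>\<not> fin_nats (\<lambda>n. n \<^bold>\<in> a))) p" for a
    by (rule fimpI) (rule inf)
  ultimately show ?thesis
    unfolding almost_disjoint_ext_def fconj_iff fall_iff[of _ p] using nf by blast
qed

text \<open>If x names a new member of a larger family, then below some r every \<open>poss\<close>
  of x is positive. There are only countably many conditions, so tightness yields one a in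
  \<open>A\<close> that meets all these sets infinitely often, whereas some condition below r leaves
  only finitely many common points of x and a possible.\<close>

lemma mad_ext_check:
  assumes ad: "almost_disjoint A" and P: "countable P" and p: "p \<in> P"
    and tight: "\<And>X :: nat \<Rightarrow> nat set. (\<And>i. positive A (X i)) \<Longrightarrow> \<exists>a\<in>A. \<forall>i. infinite (a \<inter> X i)"
  shows "mad_ext (check_family A) p"
proof -
  have False if q: "q \<in> P" and B: "almost_disjoint_ext B q" "family_subset (check_family A) B q"
    "(\<^bold>\<not> family_subset B (check_family A)) q" for q B
  proof -
    have "\<not> family_subset B (check_family A) q" using fnotD[OF B(3) q refl] .
    then obtain x where "\<not> (x \<^bold>\<in>\<^bold>\<in> B \<^bold>\<longrightarrow> x \<^bold>\<in>\<^bold>\<in> check_family A) q"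
      unfolding family_subset_def fall_iff by blast
    then obtain r where r: "r \<in> P" "r \<preceq> q"
      and x: "(x \<^bold>\<in>\<^bold>\<in> B) r" "(\<^bold>\<not> x \<^bold>\<in>\<^bold>\<in> check_family A) r"
      by (rule not_fimpE)
    have Binf: "(x \<^bold>\<in>\<^bold>\<in> B \<^bold>\<longrightarrow> (\<^bold>\<not> fin_nats (\<lambda>n. n \<^bold>\<in> x))) q"
      and Bad: "\<And>a. (x \<^bold>\<in>\<^bold>\<in> B \<^bold>\<longrightarrow> (\<^bold>\<forall>b. b \<^bold>\<in>\<^bold>\<in> B \<^bold>\<longrightarrow>
         (\<^bold>\<not> x \<^bold>= b) \<^bold>\<longrightarrow> fin_nats (\<lambda>n. n \<^bold>\<in> x \<^bold>\<and> n \<^bold>\<in> b))) q"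
      and AB: "\<And>a. (a \<^bold>\<in>\<^bold>\<in> check_family A \<^bold>\<longrightarrow> a \<^bold>\<in>\<^bold>\<in> B) q"
      using B(1,2) unfolding almost_disjoint_ext_def family_subset_def fconj_iff fall_iff by blast+
    have "(\<^bold>\<not> fin_nats (\<lambda>n. n \<^bold>\<in> x)) r" using fimpD[OF Binf, OF r x(1)] by simp
    then have xinf: "infinite (poss (\<lambda>n. n \<^bold>\<in> x) s)" if "s \<in> P" "s \<preceq> r" for s
      by (subst (asm) not_fin_nats_iff) (use that in auto)
    have "fin_nats (\<lambda>n. n \<^bold>\<in> x \<^bold>\<and> n \<^bold>\<in> check_real a) r" if a: "a \<in> A" for a
    proof -
      have B': "(check_real a \<^bold>\<in>\<^bold>\<in> B) r"
        using fimpD[OF AB, OF r check_familyI[OF a r(1)]] by simp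
      \<comment> \<open>Almost disjointness of \<open>B\<close> speaks of distinct members, so x has
        to be forced to differ from a.\<close>
      have ne: "(\<^bold>\<not> x \<^bold>= check_real a) r"
      proof (rule fnotI)
        fix s assume s: "s \<in> P" "s \<preceq> r" "(x \<^bold>= check_real a) s"
        have "(x \<^bold>\<in>\<^bold>\<in> check_family A) s"
          unfolding check_family_def ground_family_iff
          using real_eq_down[OF s(3)] a refl by blast
        then show False using fnotD[OF x(2) s(1,2)] by blast
      qed
      have "(\<^bold>\<forall>b. b \<^bold>\<in>\<^bold>\<in> B \<^bold>\<longrightarrow>
         (\<^bold>\<not> x \<^bold>= b) \<^bold>\<longrightarrow> fin_nats (\<lambda>n. n \<^bold>\<in> x \<^bold>\<and> n \<^bold>\<in> b)) r"
        using fimpD[OF Bad, OF r x(1)] by simp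
      then have "(check_real a \<^bold>\<in>\<^bold>\<in> B \<^bold>\<longrightarrow> (\<^bold>\<not> x \<^bold>= check_real a) \<^bold>\<longrightarrow>
          fin_nats (\<lambda>n. n \<^bold>\<in> x \<^bold>\<and> n \<^bold>\<in> check_real a)) r"
        by (simp add: fall_iff)
      from fimpD[OF this, OF r(1) refl B'] have "((\<^bold>\<not> x \<^bold>= check_real a) \<^bold>\<longrightarrow>
          fin_nats (\<lambda>n. n \<^bold>\<in> x \<^bold>\<and> n \<^bold>\<in> check_real a)) r" by simp
      from fimpD[OF this, OF r(1) refl ne] show ?thesis by simp
    qed
    then have adx: "\<exists>t\<in>P. t \<preceq> s \<and> finite (poss (\<lambda>n. n \<^bold>\<in> x) t \<inter> a)" if "a \<in> A" "s \<in> P" "s \<preceq> r" for a s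
    proof -
      have "poss (\<lambda>n. n \<^bold>\<in> x \<^bold>\<and> n \<^bold>\<in> check_real a) t = poss (\<lambda>n. n \<^bold>\<in> x) t \<inter> a" for t
        unfolding poss_def fconj_iff using check_real_iff by blast
      then show ?thesis
        using \<open>\<And>a. a \<in> A \<Longrightarrow> fin_nats (\<lambda>n. n \<^bold>\<in> x \<^bold>\<and> n \<^bold>\<in> check_real a) r\<close>[OF that(1)] that(2,3)
        by (subst (asm) fin_nats_iff) auto
    qed
    have pos: "positive A (poss (\<lambda>n. n \<^bold>\<in> x) s)" if s: "s \<in> P" "s \<preceq> r" for s
      unfolding positive_def
    proof (intro allI impI, elim conjE)
      fix F assume F: "finite F" "F \<subseteq> A"
      \<comment> \<open>Some t below s bounds the intersection of x with each of the finitely many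
        sets in \<open>F\<close>. The infinite rest of \<open>poss\<close> at t lies in
        \<open>poss\<close> at s and outside \<Union>F.\<close>
      have "\<exists>t\<in>P. t \<preceq> s \<and> (\<forall>a\<in>F. finite (poss (\<lambda>n. n \<^bold>\<in> x) t \<inter> a))"
      proof (rule finite_dense[OF F(1) s(1)])
        show "\<exists>u\<in>P. u \<preceq> t \<and> finite (poss (\<lambda>n. n \<^bold>\<in> x) u \<inter> a)" if "a \<in> F" "t \<in> P" "t \<preceq> s" for a t
          using adx that F(2) s trans by blast
      qed (meson Int_mono finite_subset poss_mono subset_refl)
      then obtain t where t: "t \<in> P" "t \<preceq> s" "\<And>a. a \<in> F \<Longrightarrow> finite (poss (\<lambda>n. n \<^bold>\<in> x) t \<inter> a)" by blast
      have "infinite (poss (\<lambda>n. n \<^bold>\<in> x) t)" using xinf t s trans by blast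
      moreover have "finite (\<Union>a\<in>F. poss (\<lambda>n. n \<^bold>\<in> x) t \<inter> a)" using F t by blast
      ultimately have "infinite (poss (\<lambda>n. n \<^bold>\<in> x) t - (\<Union>a\<in>F. poss (\<lambda>n. n \<^bold>\<in> x) t \<inter> a))" by simp
      moreover have "poss (\<lambda>n. n \<^bold>\<in> x) t - (\<Union>a\<in>F. poss (\<lambda>n. n \<^bold>\<in> x) t \<inter> a) \<subseteq> poss (\<lambda>n. n \<^bold>\<in> x) s - \<Union>F"
        using poss_mono[OF t(2)] by blast
      ultimately show "infinite (poss (\<lambda>n. n \<^bold>\<in> x) s - \<Union>F)" using finite_subset by blast
    qed
    define e where "e = from_nat_into {s \<in> P. s \<preceq> r}"
    have ne: "{s \<in> P. s \<preceq> r} \<noteq> {}" using r refl by blast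
    have "range e = {s \<in> P. s \<preceq> r}"
      unfolding e_def using P ne by (intro range_from_nat_into) auto
    then obtain a where a: "a \<in> A" "\<And>s. s \<in> P \<Longrightarrow> s \<preceq> r \<Longrightarrow> infinite (a \<inter> poss (\<lambda>n. n \<^bold>\<in> x) s)"
      using tight[of "\<lambda>i. poss (\<lambda>n. n \<^bold>\<in> x) (e i)"] pos
      by (smt (verit, best) imageE mem_Collect_eq rangeI)
    then show False using adx[OF a(1) r(1) refl] r trans by (metis Int_commute)
  qed
  then have "(\<^bold>\<not> (\<^bold>\<exists>B. almost_disjoint_ext B \<^bold>\<and> family_subset (check_family A) B \<^bold>\<and>
      (\<^bold>\<not> family_subset B (check_family A)))) p"
    by (intro fnotI, elim fexE) (auto simp: fconj_iff)
  then show ?thesis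
    unfolding mad_ext_def fconj_iff using almost_disjoint_ext_check[OF ad p] by simp
qed

text \<open>The sets \<open>poss \<rho> q\<close>, for q below p, form a countable list to which the
  hypothesis applies. Then p itself and the pair of a and b are as required, because no index is
  touched by both.\<close>

lemma comb_witness_countable:
  assumes P: "countable P"
    and W: "\<And>X :: nat \<Rightarrow> nat set. (\<And>i. infinite (X i)) \<Longrightarrow> \<exists>a\<in>A. \<exists>b\<in>A.
      touch C a \<inter> touch C b = {} \<and> (\<forall>i. infinite (touch C a \<inter> X i) \<and> infinite (touch C b \<inter> X i))"
  shows "comb_witness C A"
  unfolding comb_witness_def
proof (intro allI impI ballI)
  fix \<rho> p assume p: "p \<in> P" and inf: "\<forall>q\<in>P. q \<preceq> p \<longrightarrow> infinite (poss \<rho> q)"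
  define e where "e = from_nat_into {q \<in> P. q \<preceq> p}"
  have ne: "{q \<in> P. q \<preceq> p} \<noteq> {}" using p refl by blast
  have e: "range e = {q \<in> P. q \<preceq> p}"
    unfolding e_def using P ne by (intro range_from_nat_into) auto
  then have "infinite (poss \<rho> (e i))" for i using inf by blast
  then obtain a b where ab: "a \<in> A" "b \<in> A" "touch C a \<inter> touch C b = {}"
    "\<forall>i. infinite (touch C a \<inter> poss \<rho> (e i)) \<and> infinite (touch C b \<inter> poss \<rho> (e i))"
    using W[of "\<lambda>i. poss \<rho> (e i)"] by blast
  have "infinite (poss \<rho> r \<inter> touch C c)" if "c \<in> {a, b}" "r \<in> P" "r \<preceq> p" for c r
  proof -
    have "r \<in> range e" using e that by simp
    then obtain i where "r = e i" by blast
    then show ?thesis using ab(4) that(1) by (auto simp: Int_commute)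
  qed
  moreover have "poss \<rho> p \<inter> (\<Inter>c\<in>{a, b}. touch C c) = {}" using ab(3) by auto
  ultimately show "\<exists>q\<in>P. q \<preceq> p \<and> (\<exists>F. finite F \<and> F \<noteq> {} \<and> F \<subseteq> A \<and>
        (\<forall>a\<in>F. \<forall>r\<in>P. r \<preceq> q \<longrightarrow> infinite (poss \<rho> r \<inter> touch C a)) \<and>
        finite (poss \<rho> q \<inter> (\<Inter>a\<in>F. touch C a)))"
    using p ab(1,2) refl by (intro bexI[of _ p] conjI exI[of _ "{a, b}"]) auto
qed

end

section \<open>Cohen forcing\<close>

interpretation cohen: preorder_forcing cohen cohen_le
  by unfold_locales (auto simp: cohen_le_def)

text \<open>Generic in the index set, because products over different index sets are compared
  below.\<close>

interpretation product: preorder_forcing "cohen_product K" cohen_product_le for K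
  by unfold_locales (auto simp: cohen_product_le_def cohen_le_def intro: prefix_order.trans)

abbreviation "product_poss K \<equiv> preorder_forcing.poss (cohen_product K) cohen_product_le"
abbreviation "product_downward K \<equiv> preorder_forcing.downward (cohen_product K) cohen_product_le"
abbreviation "product_comb_witness K \<equiv> preorder_forcing.comb_witness (cohen_product K) cohen_product_le"

section \<open>Countable products and the reduction to countably many coordinates\<close>

lemma countable_cohen: "countable cohen"
  by (rule countableI_type)

text \<open>A condition is determined by the graph of its nonempty coordinates, a finite subset of a
  countable set.\<close>

lemma countable_cohen_product:
  assumes "countable T"
  shows "countable (cohen_product T)"
proof (rule countable_image_inj_on)
  let ?graph = "\<lambda>p :: 'a \<Rightarrow> cohen_cond. {(i, p i) |i. p i \<noteq> []}"
  have "?graph ` cohen_product T \<subseteq> {F. finite F \<and> F \<subseteq> T \<times> UNIV}"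
    by (auto simp: cohen_product_def)
  moreover have "countable {F. finite F \<and> F \<subseteq> T \<times> (UNIV :: cohen_cond set)}"
    using assms by (intro countable_Collect_finite_subset countable_SIGMA countableI_type)
  ultimately show "countable (?graph ` cohen_product T)" by (rule countable_subset)
  show "inj_on ?graph (cohen_product T)"
  proof (rule inj_onI, rule ext)
    fix p q i assume "?graph p = ?graph q"
    then have "(i, s) \<in> ?graph p \<longleftrightarrow> (i, s) \<in> ?graph q" for s by simp
    then have "s = p i \<and> p i \<noteq> [] \<longleftrightarrow> s = q i \<and> q i \<noteq> []" for s by simp
    from this[of "p i"] this[of "q i"] show "p i = q i" by auto
  qed
qed

lemma cohen_product_mono: "S \<subseteq> K \<Longrightarrow> cohen_product S \<subseteq> cohen_product K"
  by (auto simp: cohen_product_def)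

text \<open>Closing off as in the Loewenheim-Skolem theorem: for every condition q over the current
  coordinates and every n possible below q, the support of one witness \<open>g q n\<close> is
  added. After \<omega> rounds the set is closed, because each condition has finite support and so
  appears at a finite round.\<close>

lemma cohen_product_closure:
  assumes p: "p \<in> cohen_product K"
  obtains S where "countable S" "S \<subseteq> K" "p \<in> cohen_product S"
    "\<And>q. q \<in> cohen_product S \<Longrightarrow> product_poss K \<rho> q \<subseteq> product_poss S \<rho> q"
proof -
  define supp where "supp q = {i. q i \<noteq> []}" for q :: "'a \<Rightarrow> cohen_cond"
  define g where "g q n = (SOME r. r \<in> cohen_product K \<and> cohen_product_le r q \<and> \<rho> n r)" for q n
  have g: "g q n \<in> cohen_product K \<and> cohen_product_le (g q n) q \<and> \<rho> n (g q n)" if "n \<in> product_poss K \<rho> q" for q n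
  proof -
    have "\<exists>r. r \<in> cohen_product K \<and> cohen_product_le r q \<and> \<rho> n r"
      using that unfolding product.poss_def by blast
    then show ?thesis unfolding g_def by (rule someI_ex)
  qed
  define step where "step T = T \<union> (\<Union>q\<in>cohen_product T. \<Union>n\<in>product_poss K \<rho> q. supp (g q n))" for T
  define St where "St j = (step ^^ j) (supp p)" for j
  have St_Suc: "St (Suc j) = step (St j)" for j by (simp add: St_def)
  have finsupp: "finite (supp q)" "supp q \<subseteq> T" if "q \<in> cohen_product T" for q T
    using that by (auto simp: cohen_product_def supp_def)
  have St: "countable (St j) \<and> St j \<subseteq> K" for j
  proof (induction j)
    case 0
    then show ?case using finsupp[OF p] by (simp add: St_def countable_finite)
  next
    case (Suc j)
    have "supp (g q n) \<subseteq> K \<and> countable (supp (g q n))" if "n \<in> product_poss K \<rho> q" for q n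
      using g[OF that] finsupp countable_finite by blast
    then show ?case
      unfolding St_Suc step_def using Suc countable_cohen_product[of "St j"]
      by (intro conjI countable_Un countable_UN) auto
  qed
  have mono: "St i \<subseteq> St j" if "i \<le> j" for i j
    by (rule lift_Suc_mono_le[OF _ that]) (auto simp: St_Suc step_def)
  show ?thesis
  proof
    show "countable (\<Union>j. St j)" "(\<Union>j. St j) \<subseteq> K" using St by auto
    have "supp p \<subseteq> (\<Union>j. St j)" using UN_upper[of 0 UNIV St] by (simp add: St_def)
    then show "p \<in> cohen_product (\<Union>j. St j)" using p by (auto simp: cohen_product_def supp_def)
    fix q assume q: "q \<in> cohen_product (\<Union>j. St j)"
    then have "\<exists>j. i \<in> St j" if "i \<in> supp q" for i using finsupp[OF q] that by blast
    then obtain f where f: "\<And>i. i \<in> supp q \<Longrightarrow> i \<in> St (f i)" by metis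
    \<comment> \<open>A round that contains the whole support of q. If the support is empty, the
      value of \<open>Max\<close> is arbitrary, but every round serves.\<close>
    define j where "j = Max (f ` supp q)"
    have j: "f i \<le> j" if "i \<in> supp q" for i
      unfolding j_def using that finsupp(1)[OF q] by simp
    have "supp q \<subseteq> St j" using f j mono by blast
    then have qj: "q \<in> cohen_product (St j)" using q by (auto simp: cohen_product_def supp_def)
    show "product_poss K \<rho> q \<subseteq> product_poss (\<Union>j. St j) \<rho> q"
    proof
      fix n assume n: "n \<in> product_poss K \<rho> q"
      have "supp (g q n) \<subseteq> St (Suc j)" unfolding St_Suc step_def using qj n by blast
      then have "supp (g q n) \<subseteq> (\<Union>j. St j)" by blast
      then have "g q n \<in> cohen_product (\<Union>j. St j)"
        using g[OF n] by (auto simp: cohen_product_def supp_def)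
      then show "n \<in> product_poss (\<Union>j. St j) \<rho> q"
        using g[OF n] unfolding product.poss_def by blast
    qed
  qed
qed

text \<open>A name for a subset of \<open>\<omega>\<close> may involve uncountably many coordinates.  Restricting it to a
  countable set of coordinates that decides as much about it reduces the case of an arbitrary
  index set to the countable one, without nice names or the countable chain condition.\<close>
lemma comb_witness_any_index:
  fixes K :: "'k set"
  assumes nat: "\<And>N :: nat set. product_comb_witness N C A"
  shows "product_comb_witness K C A"
  unfolding product.comb_witness_def
proof (intro allI impI ballI)
  fix \<rho> p assume down: "product_downward K \<rho>" and p: "p \<in> cohen_product K"
    and inf: "\<forall>q\<in>cohen_product K. cohen_product_le q p \<longrightarrow> infinite (product_poss K \<rho> q)"
  obtain S where S: "countable S" "S \<subseteq> K" "p \<in> cohen_product S"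
    and close: "\<And>q. q \<in> cohen_product S \<Longrightarrow> product_poss K \<rho> q \<subseteq> product_poss S \<rho> q"
    using cohen_product_closure[OF p, of \<rho>] by metis
  \<comment> \<open>The countably many coordinates in \<open>S\<close> are renamed into natural
    numbers, so that the hypothesis applies to \<open>N\<close>.\<close>
  define e where "e = to_nat_on S"
  define N where "N = e ` S"
  have e: "inj_on e S" unfolding e_def using S(1) by (rule inj_on_to_nat_on)
  \<comment> \<open>\<open>up\<close> moves a condition over \<open>N\<close> to the coordinates in
    \<open>S\<close>; \<open>dn\<close>, defined next, forgets the coordinates outside
    \<open>S\<close> and moves the rest to \<open>N\<close>.\<close>
  define up where "up s = (\<lambda>i. if i \<in> S then s (e i) else [])" for s :: "nat \<Rightarrow> cohen_cond"
  define dn where "dn q = (\<lambda>j. if j \<in> N then q (inv_into S e j) else [])" for q :: "'k \<Rightarrow> cohen_cond"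
  have up_S: "up s \<in> cohen_product S" if "s \<in> cohen_product N" for s
  proof -
    have "{i. up s i \<noteq> []} \<subseteq> S" "e ` {i. up s i \<noteq> []} \<subseteq> {j. s j \<noteq> []}"
      by (auto simp: up_def split: if_splits)
    moreover from this have "finite {i. up s i \<noteq> []}"
      using that e by (metis (mono_tags, lifting) cohen_product_def finite_imageD finite_subset inj_on_subset mem_Collect_eq)
    ultimately show ?thesis by (simp add: cohen_product_def cohen_def)
  qed
  then have up_K: "up s \<in> cohen_product K" if "s \<in> cohen_product N" for s
    using that cohen_product_mono[OF S(2)] by blast
  have dn_N: "dn q \<in> cohen_product N" if "q \<in> cohen_product K" for q
  proof -
    have "{j. dn q j \<noteq> []} \<subseteq> N" by (auto simp: dn_def)
    moreover have "{j. dn q j \<noteq> []} \<subseteq> e ` {i. q i \<noteq> []}"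
    proof
      fix j assume "j \<in> {j. dn q j \<noteq> []}"
      then have "j \<in> N" "q (inv_into S e j) \<noteq> []" by (auto simp: dn_def split: if_splits)
      then show "j \<in> e ` {i. q i \<noteq> []}"
        by (intro image_eqI[of _ _ "inv_into S e j"]) (auto simp: N_def f_inv_into_f)
    qed
    then have "finite {j. dn q j \<noteq> []}" using that by (auto simp: cohen_product_def intro: finite_subset)
    ultimately show ?thesis by (simp add: cohen_product_def cohen_def)
  qed
  have up_dn: "up (dn q) i = (if i \<in> S then q i else [])" for q i
    using e by (auto simp: up_def dn_def N_def)
  have up_le: "cohen_product_le (up s) (up t)" if "cohen_product_le s t" for s t
    using that by (auto simp: cohen_product_le_def up_def cohen_le_def)
  have dn_le: "cohen_product_le (dn s) (dn t)" if "cohen_product_le s t" for s t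
    using that by (auto simp: cohen_product_le_def dn_def cohen_le_def)
  have dn_up: "dn (up s) = s" if "s \<in> cohen_product N" for s
  proof
    fix j show "dn (up s) j = s j"
    proof (cases "j \<in> N")
      case True
      then have "inv_into S e j \<in> S" "e (inv_into S e j) = j"
        unfolding N_def by (auto intro: inv_into_into f_inv_into_f)
      then show ?thesis using True by (simp add: dn_def up_def)
    next
      case False
      then have "s j = []" using that unfolding cohen_product_def by blast
      then show ?thesis using False by (simp add: dn_def)
    qed
  qed
  have up_dn_S: "up (dn q) = q" if "q \<in> cohen_product S" for q
  proof
    fix i
    have "q i = []" if "i \<notin> S" using that \<open>q \<in> cohen_product S\<close> unfolding cohen_product_def by blast
    then show "up (dn q) i = q i" by (simp add: up_dn)
  qed
  define \<rho>' where "\<rho>' n s = \<rho> n (up s)" for n s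
  have down': "product_downward N \<rho>'"
    using down up_K up_le unfolding product.downward_def \<rho>'_def by blast
  \<comment> \<open>By the choice of \<open>S\<close>, a witness below \<open>up s\<close> can be
    taken over \<open>S\<close>, and \<open>dn\<close> moves it to \<open>N\<close> without
    loss.\<close>
  have poss_up: "product_poss K \<rho> (up s) \<subseteq> product_poss N \<rho>' s" if s: "s \<in> cohen_product N" for s
  proof
    fix n assume "n \<in> product_poss K \<rho> (up s)"
    then obtain r where r: "r \<in> cohen_product S" "cohen_product_le r (up s)" "\<rho> n r"
      using close[OF up_S[OF s]] by (auto simp: product.poss_def)
    have "dn r \<in> cohen_product N" using r(1) cohen_product_mono[OF S(2)] dn_N by blast
    moreover have "cohen_product_le (dn r) s" using dn_le[OF r(2)] dn_up[OF s] by simp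
    moreover have "\<rho>' n (dn r)" using r up_dn_S by (simp add: \<rho>'_def)
    ultimately show "n \<in> product_poss N \<rho>' s" by (auto simp: product.poss_def)
  qed
  have poss_dn: "product_poss N \<rho>' (dn r) \<subseteq> product_poss K \<rho> r" if r: "r \<in> cohen_product K" for r
  proof
    fix n assume "n \<in> product_poss N \<rho>' (dn r)"
    then obtain s where s: "s \<in> cohen_product N" "cohen_product_le s (dn r)" "\<rho> n (up s)"
      by (auto simp: product.poss_def \<rho>'_def)
    \<comment> \<open>The two conditions are amalgamated: \<open>up s\<close> on \<open>S\<close>,
      where it extends r, and r elsewhere.\<close>
    define t where "t = (\<lambda>i. if i \<in> S then up s i else r i)"
    have "{i. t i \<noteq> []} \<subseteq> {i. up s i \<noteq> []} \<union> {i. r i \<noteq> []}" by (auto simp: t_def)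
    then have t: "t \<in> cohen_product K"
      using up_K[OF s(1)] r finite_subset[of "{i. t i \<noteq> []}"]
      by (auto simp: cohen_product_def cohen_def)
    have "cohen_product_le t (up s)" by (auto simp: cohen_product_le_def cohen_le_def t_def up_def)
    then have "\<rho> n t" using down t up_K[OF s(1)] s(3) unfolding product.downward_def by blast
    moreover have "cohen_product_le t r"
      using up_le[OF s(2)] by (auto simp: cohen_product_le_def cohen_le_def t_def up_dn split: if_splits)
    ultimately show "n \<in> product_poss K \<rho> r" using t by (auto simp: product.poss_def)
  qed
  have "infinite (product_poss N \<rho>' s)" if s: "s \<in> cohen_product N" "cohen_product_le s (dn p)" for s
  proof -
    have "cohen_product_le (up s) p" using up_le[OF s(2)] up_dn_S[OF S(3)] by simp
    then have "infinite (product_poss K \<rho> (up s))" using inf up_K[OF s(1)] by blast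
    then show ?thesis using poss_up[OF s(1)] finite_subset by blast
  qed
  then obtain q F where q: "q \<in> cohen_product N" "cohen_product_le q (dn p)"
    and F: "finite F" "F \<noteq> {}" "F \<subseteq> A"
    and infF: "\<And>a r. a \<in> F \<Longrightarrow> r \<in> cohen_product N \<Longrightarrow> cohen_product_le r q \<Longrightarrow>
      infinite (product_poss N \<rho>' r \<inter> touch C a)"
    and finF: "finite (product_poss N \<rho>' q \<inter> (\<Inter>a\<in>F. touch C a))"
    using nat[of N, unfolded product.comb_witness_def, rule_format, OF down' dn_N[OF p]] by metis
  \<comment> \<open>The inclusion \<open>poss_dn\<close> transfers the infinite intersections from
    \<open>N\<close> to \<open>K\<close>, and \<open>poss_up\<close> transfers the finite
    one.\<close>
  have "infinite (product_poss K \<rho> r \<inter> touch C a)"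
    if "a \<in> F" "r \<in> cohen_product K" "cohen_product_le r (up q)" for a r
  proof -
    have "cohen_product_le (dn r) q" using dn_le[OF that(3)] dn_up[OF q(1)] by simp
    then have "infinite (product_poss N \<rho>' (dn r) \<inter> touch C a)" using infF that(1) dn_N[OF that(2)] by blast
    then show ?thesis using poss_dn[OF that(2)] by (meson Int_mono finite_subset subset_refl)
  qed
  moreover have "finite (product_poss K \<rho> (up q) \<inter> (\<Inter>a\<in>F. touch C a))"
    by (rule finite_subset[OF _ finF]) (use poss_up[OF q(1)] in blast)
  moreover have "cohen_product_le (up q) p" using up_le[OF q(2)] up_dn_S[OF S(3)] by simp
  ultimately show "\<exists>q\<in>cohen_product K. cohen_product_le q p \<and> (\<exists>F. finite F \<and> F \<noteq> {} \<and> F \<subseteq> A \<and>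
        (\<forall>a\<in>F. \<forall>r\<in>cohen_product K. cohen_product_le r q \<longrightarrow> infinite (product_poss K \<rho> r \<inter> touch C a)) \<and>
        finite (product_poss K \<rho> q \<inter> (\<Inter>a\<in>F. touch C a)))"
    using up_K[OF q(1)] F by (intro bexI[of _ "up q"] conjI exI[of _ F]) auto
qed

lemma cohen_witness_iff:
  assumes "fin_seq C"
  shows "cohen_witness \<kappa> C A \<longleftrightarrow> product_comb_witness (Field \<kappa>) C A"
proof
  assume "cohen_witness \<kappa> C A"
  then show "product_comb_witness (Field \<kappa>) C A"
    unfolding cohen_witness_def product.forces_witnesses_non_fi_def product.forced_def
    by (intro product.comb_witnessI) blast
next
  assume "product_comb_witness (Field \<kappa>) C A"
  then show "cohen_witness \<kappa> C A"
    unfolding cohen_witness_def product.forces_witnesses_non_fi_def product.forced_def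
    using product.witnesses_non_fi_extI[OF _ assms] by blast
qed

text \<open>Every set N of natural numbers is the field of the cardinal order
  \<open>card_of N\<close>, so a hypothesis on cardinals covers all countable index sets that the
  reduction uses.\<close>

lemma cohen_witness_any_index:
  fixes \<kappa> :: "'k rel"
  assumes C: "fin_seq C" and nat: "\<And>\<mu> :: nat rel. Card_order \<mu> \<Longrightarrow> cohen_witness \<mu> C A"
  shows "cohen_witness \<kappa> C A"
proof -
  have "product_comb_witness N C A" for N :: "nat set"
    using nat[OF card_of_Card_order, of N] unfolding cohen_witness_iff[OF C] Field_card_of .
  then show ?thesis unfolding cohen_witness_iff[OF C] by (rule comb_witness_any_index)
qed

section \<open>Properties in the ground model and assembly of the pair\<close>

lemma almost_disjoint_of_tight:
  assumes A: "selector_ad A"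
    and tight: "\<And>X :: nat \<Rightarrow> nat set. (\<And>i. positive A (X i)) \<Longrightarrow> \<exists>a\<in>A. \<forall>i. infinite (a \<inter> X i)"
  shows "almost_disjoint A"
proof -
  have "infinite A"
  proof
    assume fin: "finite A"
    have pos: "positive A UNIV" using positive_block_vimage[OF A, of UNIV] by simp
    \<comment> \<open>If \<open>A\<close> is finite, the complement of its union is positive, and
      tightness yields a member of \<open>A\<close> that meets it, which is absurd.\<close>
    have "positive A (- \<Union>A)"
      unfolding positive_def
    proof (intro allI impI, elim conjE)
      fix F assume "F \<subseteq> A"
      then have "- \<Union>A - \<Union>F = UNIV - \<Union>A" by blast
      then show "infinite (- \<Union>A - \<Union>F)" using pos fin unfolding positive_def by simp
    qed
    then obtain a where "a \<in> A" "infinite (a \<inter> - \<Union>A)" using tight[of "\<lambda>_. - \<Union>A"] by blast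
    moreover have "a \<inter> - \<Union>A = {}" using \<open>a \<in> A\<close> by blast
    ultimately show False by simp
  qed
  then show ?thesis using A unfolding almost_disjoint_def selector_ad_def by blast
qed

text \<open>An infinite set almost disjoint from all members of \<open>A\<close> is positive, so
  tightness yields a member that meets it infinitely often.\<close>

lemma mad_of_tight:
  assumes ad: "almost_disjoint A"
    and tight: "\<And>X :: nat \<Rightarrow> nat set. (\<And>i. positive A (X i)) \<Longrightarrow> \<exists>a\<in>A. \<forall>i. infinite (a \<inter> X i)"
  shows "mad A"
  unfolding mad_def
proof (intro conjI ad notI, elim exE conjE)
  fix B assume B: "almost_disjoint B" "A \<subset> B"
  then obtain x where x: "x \<in> B" "x \<notin> A" by blast
  have fin: "finite (x \<inter> a)" if "a \<in> A" for a
  proof -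
    have "a \<in> B" "x \<noteq> a" using B(2) x that by auto
    then show ?thesis using B(1) x(1) unfolding almost_disjoint_def by blast
  qed
  have "positive A x"
    unfolding positive_def
  proof (intro allI impI, elim conjE)
    fix F assume F: "finite F" "F \<subseteq> A"
    then have "finite (\<Union>a\<in>F. x \<inter> a)" using fin by blast
    moreover have "infinite x" using B x by (simp add: almost_disjoint_def)
    moreover have "x - \<Union>F = x - (\<Union>a\<in>F. x \<inter> a)" by blast
    ultimately show "infinite (x - \<Union>F)" by simp
  qed
  then obtain a where "a \<in> A" "infinite (a \<inter> x)" using tight[of "\<lambda>_. x"] by blast
  then show False using fin by (simp add: Int_commute)
qed

text \<open>The traces of a and b on I are infinite and disjoint, so these two already violate
  centeredness.\<close>

lemma witnesses_non_fiI:
  assumes C: "fin_seq C"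
    and W: "\<And>I. infinite I \<Longrightarrow> \<exists>a\<in>A. \<exists>b\<in>A. touch C a \<inter> touch C b = {} \<and>
      infinite (touch C a \<inter> I) \<and> infinite (touch C b \<inter> I)"
  shows "witnesses_non_fi C A"
  unfolding witnesses_non_fi_def
proof (intro conjI C allI impI notI)
  fix I assume "infinite I" and cent: "centered (traces I C A)"
  then obtain a b where ab: "a \<in> A" "b \<in> A" "touch C a \<inter> touch C b = {}"
    "infinite (touch C a \<inter> I)" "infinite (touch C b \<inter> I)" using W by blast
  have "touch C c \<inter> I \<in> traces I C A" if "c \<in> A" "infinite (touch C c \<inter> I)" for c
  proof -
    have "touch C c \<inter> I = {n \<in> I. c \<inter> C n \<noteq> {}}" by (auto simp: touch_def)
    then show ?thesis using that unfolding traces_def by blast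
  qed
  then have "{touch C a \<inter> I, touch C b \<inter> I} \<subseteq> traces I C A" using ab by blast
  then have "infinite (\<Inter>{touch C a \<inter> I, touch C b \<inter> I})"
    using cent unfolding centered_def by (metis finite.emptyI finite_insert insert_not_empty)
  moreover have "\<Inter>{touch C a \<inter> I, touch C b \<inter> I} = {}" using ab(3) by blast
  ultimately show False by simp
qed

lemma cohen_indestructible_exists:
  assumes continuum_hypothesis
  obtains A C where "mad A" "\<not> fin_intersecting A" "cohen.forces_mad_non_fi A" "witnesses_non_fi C A"
    "\<forall>\<kappa> :: nat rel. cohen_witness \<kappa> C A"
proof -
  obtain A where A: "selector_ad A"
    and tight: "\<And>X :: nat \<Rightarrow> nat set. (\<And>i. positive A (X i)) \<Longrightarrow> \<exists>a\<in>A. \<forall>i. infinite (a \<inter> X i)"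
    and W: "\<And>X :: nat \<Rightarrow> nat set. (\<And>i. infinite (X i)) \<Longrightarrow> \<exists>a\<in>A. \<exists>b\<in>A. block ` a \<inter> block ` b = {} \<and>
       (\<forall>i. infinite (block ` a \<inter> X i) \<and> infinite (block ` b \<inter> X i))"
    using tight_family_exists[OF assms] by metis
  define C where "C n = block -` {n}" for n
  have C: "fin_seq C" unfolding C_def by (rule fin_seq_block)
  \<comment> \<open>This identifies the block images in the tightness property with the touched
    indices in the forcing lemmas.\<close>
  have touch: "touch C a = block ` a" for a by (auto simp: touch_def C_def)
  have ad: "almost_disjoint A" using A tight by (rule almost_disjoint_of_tight)
  have mad: "mad A" using ad tight by (rule mad_of_tight)
  have wit: "witnesses_non_fi C A"
  proof (rule witnesses_non_fiI[OF C])
    fix I :: "nat set" assume "infinite I"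
    then show "\<exists>a\<in>A. \<exists>b\<in>A. touch C a \<inter> touch C b = {} \<and>
      infinite (touch C a \<inter> I) \<and> infinite (touch C b \<inter> I)"
      using W[of "\<lambda>_. I"] unfolding touch by blast
  qed
  then have "\<not> fin_intersecting A"
    unfolding witnesses_non_fi_def fin_intersecting_def by blast
  moreover have "cohen.forces_mad_non_fi A"
    unfolding cohen.forces_mad_non_fi_def cohen.forced_def cohen.fconj_iff
  proof (intro ballI conjI)
    fix p assume p: "p \<in> cohen"
    show "cohen.mad_ext (cohen.check_family A) p"
      using ad countable_cohen p tight by (rule cohen.mad_ext_check)
    have "cohen.comb_witness C A"
      by (rule cohen.comb_witness_countable[OF countable_cohen]) (use W touch in simp)
    then show "cohen.fnot (cohen.fin_intersecting_ext (cohen.check_family A)) p"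
      using cohen.witnesses_non_fi_extI[OF _ C] p by (intro cohen.not_fin_intersecting_extI) auto
  qed
  \<comment> \<open>An index set of natural numbers is countable, hence so is the product, and the
    countable case applies.\<close>
  moreover have "cohen_witness \<kappa> C A" for \<kappa> :: "nat rel"
    unfolding cohen_witness_iff[OF C]
    by (rule product.comb_witness_countable[OF countable_cohen_product]) (use W touch in simp_all)
  ultimately show ?thesis using mad wit that by blast
qed

theorem theorem8:
  assumes "continuum_hypothesis"
  shows "\<exists>A C. (A, C) = uniform_pair \<and>
     mad A \<and> \<not> fin_intersecting A \<and>
     forcing_notion.forces_mad_non_fi cohen cohen_le A \<and>
     witnesses_non_fi C A \<and>
     (\<forall>\<kappa> :: 'k rel. Card_order \<kappa> \<longrightarrow> cohen_witness \<kappa> C A)"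
proof -
  \<comment> \<open>\<open>good\<close> is the predicate behind the choice in
    \<open>uniform_pair\<close>, so a single good pair makes the chosen pair good.\<close>
  define good where "good = (\<lambda>(A, C). mad A \<and> \<not> fin_intersecting A \<and>
     forcing_notion.forces_mad_non_fi cohen cohen_le A \<and> witnesses_non_fi C A \<and>
     (\<forall>\<kappa> :: nat rel. Card_order \<kappa> \<longrightarrow> cohen_witness \<kappa> C A))"
  obtain A0 C0 where "mad A0" "\<not> fin_intersecting A0" "cohen.forces_mad_non_fi A0"
    "witnesses_non_fi C0 A0" "\<forall>\<kappa> :: nat rel. cohen_witness \<kappa> C0 A0"
    using cohen_indestructible_exists[OF assms] .
  then have "good (A0, C0)" by (simp add: good_def)
  then have "good uniform_pair"
    unfolding uniform_pair_def good_def by (rule someI)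
  obtain A C where AC: "(A, C) = uniform_pair" by (metis surj_pair)
  with \<open>good uniform_pair\<close> have "good (A, C)" by (simp only:)
  then have AC': "mad A \<and> \<not> fin_intersecting A \<and>
     forcing_notion.forces_mad_non_fi cohen cohen_le A \<and> witnesses_non_fi C A"
    and nat: "\<forall>\<kappa> :: nat rel. Card_order \<kappa> \<longrightarrow> cohen_witness \<kappa> C A"
    unfolding good_def by blast+
  from AC' have "fin_seq C" by (simp add: witnesses_non_fi_def)
  \<comment> \<open>The choice guarantees only index sets of natural numbers. The transfer holds for
    every pair with this guarantee, so it reaches the type \<open>'k\<close> without changing
    \<open>A\<close> and \<open>C\<close>.\<close>
  then have "cohen_witness \<kappa> C A" for \<kappa> :: "'k rel"
    by (rule cohen_witness_any_index) (rule nat[rule_format])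
  then show ?thesis using AC AC' by blast
qed

end
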